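(* Let $(Q_{\mathrm{init},\varepsilon})_{\varepsilon\ge0}$ be a family of initial data such that each $Q_{\mathrm{init},\varepsilon}\in C^1[0,1]$ is non-decreasing and satisfies $Q_{\mathrm{init},\varepsilon}(0)=0$, $Q_{\mathrm{init},\varepsilon}(1)=\Phi_F$, $$\frac{d}{d\eta}Q_{\mathrm{init},\varepsilon}(1)>K(\Phi_F),\qquad \frac{d}{d\eta}Q_{\mathrm{init},\varepsilon}(1)-\frac{d}{d\eta}Q_{\mathrm{init},\varepsilon}(0)=K(\Phi_F)-K(0),$$ and such that $Q_{\mathrm{init},\varepsilon}\to Q_{\mathrm{init},0}$ in $C^1[0,1]$ as $\varepsilon\to0^+$. Let $(Q_\varepsilon,N_\varepsilon)$ be the corresponding classical solution of system (S) with initial datum $Q_{\mathrm{init},\varepsilon}$, and $\tau^*_\varepsilon$ its maximal existence time. Then $$\liminf_{\varepsilon\to0^+}\tau^*_\varepsilon\ge\tau^*_0 .$$ Moreover, for every $0<T<\tau_0^*$, as $\varepsilon\to0^+$, $$N_\varepsilon\to N_0\ \text{ in } C[0,T],\qquad Q_\varepsilon(T,\cdot)\to Q_0(T,\cdot)\ \text{ in } C^1[0,1].$$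
   Context: Standing assumptions: $\Phi_F>0$ is fixed and $K\in C^2(\mathbb{R})$ is a function with $K',K''$ bounded on $\mathbb{R}$ and $K(\phi)>0$ for $\phi\in[0,\Phi_F]$. System (S), for unknowns $Q(\tau,\eta)$ and $N(\tau)$: $$\partial_\tau Q+\partial_\eta Q=\frac1{N(\tau)}+K(Q)\quad(\tau>0,\ \eta\in(0,1)),\qquad Q(\tau,0)=0\quad(\tau>0),$$ $$\frac1{N(\tau)}=\partial_\eta Q(\tau,1)-K(\Phi_F)\quad(\tau>0),\qquad Q(0,\eta)=Q_{\mathrm{init}}(\eta)\quad(\eta\in[0,1]).$$ Classical solution: given $0<T\le+\infty$ and an initial datum $Q_{\mathrm{init}}\in C^1[0,1]$ that is increasing with $Q_{\mathrm{init}}(0)=0$, $Q_{\mathrm{init}}(1)=\Phi_F$ and $\frac{d}{d\eta}Q_{\mathrm{init}}(1)>K(\Phi_F)$, a pair $(Q,N)$ is a classical solution of (S) on $[0,T)$ if (1) $Q\in C^1([0,T)\times[0,1])$ is increasing in $\eta$ and $N\in C[0,T)$ is positive; (2) the equations of (S) hold in the classical sense for $\tau\in[0,T)$; (3) $K(\Phi_F)<\partial_\eta Q(\tau,1)<+\infty$ for all $\tau\in[0,T)$. Here "increasing" means non-decreasing. For initial data as in the claim there is a unique classical solution on a maximal interval $[0,\tau^* )$, $0<\tau^*\le+\infty$; the maximal existence time $\tau^*$ is the supremum of all $T$ for which a classical solution on $[0,T)$ exists. The convergences on $[0,T]$ are understood for $\varepsilon$ small enough that $\tau^*_\varepsilon>T$.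 *)

theory Defs
  imports "HOL-Analysis.Analysis"
begin

text \<open>Derivative of a function on \<open>[0,1]\<close>; one-sided at the endpoints.\<close>

abbreviation deriv01 :: "(real \<Rightarrow> real) \<Rightarrow> real \<Rightarrow> real" where
  "deriv01 f \<eta> \<equiv> vector_derivative f (at \<eta> within {0..1})"

definition C1_01 :: "(real \<Rightarrow> real) \<Rightarrow> bool" where
  "C1_01 f \<longleftrightarrow> f differentiable_on {0..1} \<and> continuous_on {0..1} (deriv01 f)"

definition converges_C1_01 :: "('e \<Rightarrow> real \<Rightarrow> real) \<Rightarrow> (real \<Rightarrow> real) \<Rightarrow> 'e filter \<Rightarrow> bool" where
  "converges_C1_01 f g F \<longleftrightarrow>
     uniform_limit {0..1} f g F \<and> uniform_limit {0..1} (\<lambda>e. deriv01 (f e)) (deriv01 g) F"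

text \<open>The half-open interval \<open>[0,T)\<close>, where \<open>T = \<infinity>\<close> is allowed.\<close>

definition times :: "ereal \<Rightarrow> real set" where
  "times T = {\<tau>. 0 \<le> \<tau> \<and> ereal \<tau> < T}"

text \<open>Partial derivatives of a function on \<open>[0,T) \<times> [0,1]\<close>; one-sided on the boundary.\<close>

definition d_tau :: "ereal \<Rightarrow> (real \<Rightarrow> real \<Rightarrow> real) \<Rightarrow> real \<Rightarrow> real \<Rightarrow> real" where
  "d_tau T Q \<tau> \<eta> = vector_derivative (\<lambda>s. Q s \<eta>) (at \<tau> within times T)"

definition d_eta :: "(real \<Rightarrow> real \<Rightarrow> real) \<Rightarrow> real \<Rightarrow> real \<Rightarrow> real" where
  "d_eta Q \<tau> \<eta> = deriv01 (Q \<tau>) \<eta>"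

definition C1_time_space :: "ereal \<Rightarrow> (real \<Rightarrow> real \<Rightarrow> real) \<Rightarrow> bool" where
  "C1_time_space T Q \<longleftrightarrow>
     (\<forall>\<eta>\<in>{0..1}. (\<lambda>\<tau>. Q \<tau> \<eta>) differentiable_on times T) \<and>
     (\<forall>\<tau>\<in>times T. Q \<tau> differentiable_on {0..1}) \<and>
     continuous_on (times T \<times> {0..1}) (\<lambda>(\<tau>, \<eta>). Q \<tau> \<eta>) \<and>
     continuous_on (times T \<times> {0..1}) (\<lambda>(\<tau>, \<eta>). d_tau T Q \<tau> \<eta>) \<and>
     continuous_on (times T \<times> {0..1}) (\<lambda>(\<tau>, \<eta>). d_eta Q \<tau> \<eta>)"

definition initial_datum :: "(real \<Rightarrow> real) \<Rightarrow> real \<Rightarrow> (real \<Rightarrow> real) \<Rightarrow> bool" where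
  "initial_datum K \<Phi> q \<longleftrightarrow>
     C1_01 q \<and> mono_on {0..1} q \<and> q 0 = 0 \<and> q 1 = \<Phi> \<and> deriv01 q 1 > K \<Phi>"

definition solves_system ::
    "(real \<Rightarrow> real) \<Rightarrow> real \<Rightarrow> ereal \<Rightarrow> (real \<Rightarrow> real) \<Rightarrow> (real \<Rightarrow> real \<Rightarrow> real) \<Rightarrow> (real \<Rightarrow> real) \<Rightarrow> bool" where
  "solves_system K \<Phi> T q Q N \<longleftrightarrow>
     (\<forall>\<tau>\<in>times T. \<tau> > 0 \<longrightarrow>
        (\<forall>\<eta>\<in>{0<..<1}. d_tau T Q \<tau> \<eta> + d_eta Q \<tau> \<eta> = 1 / N \<tau> + K (Q \<tau> \<eta>)) \<and>
        Q \<tau> 0 = 0 \<and>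
        1 / N \<tau> = d_eta Q \<tau> 1 - K \<Phi>) \<and>
     (\<forall>\<eta>\<in>{0..1}. Q 0 \<eta> = q \<eta>)"

definition classical_solution ::
    "(real \<Rightarrow> real) \<Rightarrow> real \<Rightarrow> ereal \<Rightarrow> (real \<Rightarrow> real) \<Rightarrow> (real \<Rightarrow> real \<Rightarrow> real) \<Rightarrow> (real \<Rightarrow> real) \<Rightarrow> bool" where
  "classical_solution K \<Phi> T q Q N \<longleftrightarrow>
     0 < T \<and>
     C1_time_space T Q \<and> (\<forall>\<tau>\<in>times T. mono_on {0..1} (Q \<tau>)) \<and>
     continuous_on (times T) N \<and> (\<forall>\<tau>\<in>times T. N \<tau> > 0) \<and>
     solves_system K \<Phi> T q Q N \<and>
     (\<forall>\<tau>\<in>times T. K \<Phi> < d_eta Q \<tau> 1)"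

definition max_time :: "(real \<Rightarrow> real) \<Rightarrow> real \<Rightarrow> (real \<Rightarrow> real) \<Rightarrow> ereal" where
  "max_time K \<Phi> q = Sup {T. \<exists>Q N. classical_solution K \<Phi> T q Q N}"

end

theory Submission imports Defs
begin

text \<open>
  The positivity of \<open>N\<close> can be left for the very end. Put \<open>P = \<partial>\<^sub>\<eta> Q\<close> and substitute \<open>1 / N = P(\<tau>, 1) - K(\<Phi>)\<close> into the equation. The resulting
  problem still makes sense when this quantity has any sign; its solutions are called \<^emph>\<open>relaxed\<close> here.
  Along a characteristic \<open>\<eta> - \<tau> = const\<close> one has \<open>dP/ds = K'(Q) P\<close>
  (\<open>P_along_characteristic\<close>), and since \<open>Q(\<tau>, 0) = 0\<close> the characteristic that leaves at
  \<open>\<eta> = 1\<close> re-enters at \<open>\<eta> = 0\<close> with \<open>P(\<tau>, 0) = P(\<tau>, 1) - K(\<Phi>) + K(0)\<close> (\<open>reentry\<close>). So \<open>P\<close> is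
  transported on a circle, with a prescribed jump at the joint and a growth rate that is bounded because \<open>K'\<close> is.

  Two consequences carry the proof. First, the difference of two relaxed solutions has no jump at the joint,
  so a maximum principle for \<open>exp (- \<lambda> \<tau>) \<bar>P\<^sub>1 - P\<^sub>2\<bar>\<close> bounds it by its initial value
  (\<open>relaxed_solution_stability\<close>). Second, relaxed solutions are global in time
  (\<open>relaxed_solution_exists\<close>): on a unit time interval \<open>P\<close> is given explicitly in terms of the growth rates
  \<open>K'(Q)\<close>, which turns the problem into a fixed point equation for \<open>Q\<close> alone that is of Volterra type,
  and unit intervals can be concatenated.

  A classical solution is the same as a relaxed solution with \<open>P(\<tau>, 1) > K(\<Phi>)\<close>
  (\<open>relaxed_solution_of_classical\<close>, \<open>classical_of_relaxed_solution\<close>). If \<open>T < \<tau>\<^sup>*\<^sub>0\<close>, then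
  \<open>P\<^sub>0(\<tau>, 1) - K(\<Phi>)\<close> has a positive minimum on \<open>[0,T]\<close>. By stability the global relaxed solution
  for a nearby datum keeps this quantity positive on \<open>[0,T]\<close>, so it is classical there, and the maximal time of that
  datum is at least \<open>T\<close> (\<open>max_time_ge\<close>). Stability then also yields both convergences.
\<close>

section \<open>Tools from real analysis\<close>

lemma has_derivative_real_partials:
  fixes f f2 :: "real \<Rightarrow> real \<Rightarrow> real"
  assumes "((\<lambda>x. f x y) has_real_derivative f1) (at x within X)"
    and "\<And>x y. x \<in> X \<Longrightarrow> y \<in> Y \<Longrightarrow> (f x has_real_derivative f2 x y) (at y within Y)"
    and "continuous_on (X \<times> Y) (\<lambda>(x, y). f2 x y)"
    and "x \<in> X" "y \<in> Y" "convex Y"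
  shows "((\<lambda>(x, y). f x y) has_derivative (\<lambda>(s, t). f1 * s + f2 x y * t)) (at (x, y) within X \<times> Y)"
proof -
  have "((\<lambda>(x, y). f x y) has_derivative (\<lambda>(s, t). f1 * s + blinfun_mult_right (f2 x y) t)) (at (x, y) within X \<times> Y)"
  proof (rule has_derivative_partialsI)
    show "((\<lambda>x. f x y) has_derivative (\<lambda>s. f1 * s)) (at x within X)"
      using assms(1) by (simp add: has_field_derivative_def)
    show "(f x has_derivative blinfun_apply (blinfun_mult_right (f2 x y))) (at y within Y)"
      if "x \<in> X" "y \<in> Y" for x y
      using assms(2)[OF that] by (simp add: has_field_derivative_def)
    have "continuous_on (X \<times> Y) (\<lambda>z. blinfun_mult_right (case z of (x, y) \<Rightarrow> f2 x y))"
      by (rule bounded_linear.continuous_on[OF bounded_linear_blinfun_mult_right assms(3)])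
    then show "continuous (at (x, y) within X \<times> Y) (\<lambda>(x, y). blinfun_mult_right (f2 x y))"
      using assms(4,5) by (auto simp: continuous_on_eq_continuous_within case_prod_unfold)
  qed (use assms in auto)
  then show ?thesis by simp
qed

text \<open>
  Chain rule along a path in a rectangle. One-sided derivatives at the boundary are the reason for taking
  the derivatives within sets; continuity of one of the two partial derivatives already gives joint differentiability.
\<close>

lemma has_real_derivative_along_path:
  fixes f f2 :: "real \<Rightarrow> real \<Rightarrow> real"
  assumes "((\<lambda>x. f x (b u)) has_real_derivative f1) (at (a u) within X)"
    and "\<And>x y. x \<in> X \<Longrightarrow> y \<in> Y \<Longrightarrow> (f x has_real_derivative f2 x y) (at y within Y)"
    and "continuous_on (X \<times> Y) (\<lambda>(x, y). f2 x y)"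
    and "convex Y" "u \<in> U" "a ` U \<subseteq> X" "b ` U \<subseteq> Y"
    and "(a has_real_derivative a') (at u within U)" "(b has_real_derivative b') (at u within U)"
  shows "((\<lambda>u. f (a u) (b u)) has_real_derivative f1 * a' + f2 (a u) (b u) * b') (at u within U)"
proof -
  have 1: "((\<lambda>(x, y). f x y) has_derivative (\<lambda>(s, t). f1 * s + f2 (a u) (b u) * t))
      (at (a u, b u) within (\<lambda>u. (a u, b u)) ` U)"
    by (rule has_derivative_subset[OF has_derivative_real_partials[OF assms(1-3)]]) (use assms in auto)
  have 2: "((\<lambda>u. (a u, b u)) has_derivative (\<lambda>h. (a' * h, b' * h))) (at u within U)"
    by (rule has_derivative_Pair) (use assms(8,9) in \<open>auto simp: has_field_derivative_def\<close>)
  from has_derivative_in_compose[OF 2 1] show ?thesis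
    by (simp add: has_field_derivative_def algebra_simps fun_eq_iff)
       (erule has_derivative_eq_rhs, simp add: fun_eq_iff algebra_simps)
qed

text \<open>
  Rescaling to the fixed interval \<open>[0,1]\<close> turns the moving endpoint into a parameter of the integrand.
\<close>

lemma continuous_on_integral_upto:
  fixes g :: "'z::topological_space \<Rightarrow> real \<Rightarrow> real"
  assumes "continuous_on (Z \<times> {0..c}) (\<lambda>(z, t). g z t)"
    and "continuous_on Z b" "\<And>z. z \<in> Z \<Longrightarrow> 0 \<le> b z \<and> b z \<le> c"
  shows "continuous_on Z (\<lambda>z. integral {0..b z} (g z))"
proof -
  have eq: "integral {0..b z} (g z) = b z * integral {0..1} (\<lambda>s. g z (b z * s))" if z: "z \<in> Z" for z
  proof (cases "b z = 0")
    case False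
    then have pos: "b z > 0" using assms(3)[OF z] by simp
    have "continuous_on {0..b z} (\<lambda>t. g z t)"
      by (rule continuous_on_compose2[OF assms(1), where f="\<lambda>t. (z, t)", simplified])
         (use assms(3)[OF z] z in \<open>auto intro!: continuous_intros\<close>)
    then have "(g z has_integral integral {0..b z} (g z)) (cbox 0 (b z))"
      by (auto intro!: integrable_integral integrable_continuous_real)
    from has_integral_affinity[OF this, of "b z" 0] pos
    have "((\<lambda>s. g z (b z * s)) has_integral integral {0..b z} (g z) / b z) {0..1}"
      by (simp add: image_affinity_cbox field_simps)
    then show ?thesis using pos by (simp add: integral_unique)
  qed simp
  have "continuous_on Z (\<lambda>z. integral (cbox 0 1) (\<lambda>s. g z (b z * s)))"
  proof (rule integral_continuous_on_param)
    have 1: "continuous_on (Z \<times> {0..1}) (\<lambda>p. (fst p, b (fst p) * snd p))"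
      by (intro continuous_intros continuous_on_compose2[OF assms(2)]) auto
    have 2: "(\<lambda>p. (fst p, b (fst p) * snd p)) ` (Z \<times> {0..1}) \<subseteq> Z \<times> {0..c}"
    proof clarsimp
      fix z and s :: real
      assume "z \<in> Z" "0 \<le> s" "s \<le> 1"
      then show "0 \<le> b z * s \<and> b z * s \<le> c"
        using assms(3)[of z] mult_left_le[of s "b z"] by auto
    qed
    show "continuous_on (Z \<times> cbox 0 1) (\<lambda>(z, s). g z (b z * s))"
      using continuous_on_compose2[OF assms(1) 1 2] by (simp add: case_prod_unfold)
  qed
  then have "continuous_on Z (\<lambda>z. b z * integral {0..1} (\<lambda>s. g z (b z * s)))"
    by (intro continuous_intros assms(2)) simp
  then show ?thesis by (rule continuous_on_eq) (simp add: eq)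
qed

lemma has_real_derivative_within_Un:
  assumes "(f has_real_derivative d) (at x within S)" "(f has_real_derivative d) (at x within T)"
  shows "(f has_real_derivative d) (at x within (S \<union> T))"
  using assms unfolding has_field_derivative_iff Lim_within_Un by blast

text \<open>
  Banach's fixed point theorem for a weighted supremum norm. The weight lets a Volterra operator contract
  on a whole time interval, without shortening it. The estimate with \<open>m = 0\<close> shows that \<open>F f\<close> depends on
  \<open>f\<close> only through its values on \<open>S\<close>, so functions on the whole type can stand for functions on \<open>S\<close>.
\<close>

lemma weighted_contraction_fixed_point:
  fixes F :: "('a::topological_space \<Rightarrow> real) \<Rightarrow> 'a \<Rightarrow> real" and w :: "'a \<Rightarrow> real"
  assumes "compact S" "continuous_on S w" "\<And>x. x \<in> S \<Longrightarrow> w x \<ge> 1"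
    and cont: "\<And>f. continuous_on S f \<Longrightarrow> continuous_on S (F f)"
    and contr: "\<And>f g m x. continuous_on S f \<Longrightarrow> continuous_on S g \<Longrightarrow>
      (\<And>y. y \<in> S \<Longrightarrow> \<bar>f y - g y\<bar> \<le> m * w y) \<Longrightarrow> x \<in> S \<Longrightarrow> \<bar>F f x - F g x\<bar> \<le> m / 2 * w x"
  obtains f where "continuous_on S f" "\<And>x. x \<in> S \<Longrightarrow> F f x = f x"
proof (cases "S = {}")
  case True
  then show thesis using that[of "\<lambda>_. 0"] by simp
next
  case False
  define h where "h n = (F ^^ n) (\<lambda>_. 0)" for n
  have h_Suc: "h (Suc n) = F (h n)" for n by (simp add: h_def)
  have h_cont: "continuous_on S (h n)" for n
    by (induction n) (auto simp: h_def cont)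
  obtain W where W: "\<And>x. x \<in> S \<Longrightarrow> w x \<le> W"
    using continuous_attains_sup[OF assms(1) False assms(2)] by blast
  have "bounded (h 1 ` S)"
    by (intro compact_imp_bounded compact_continuous_image h_cont assms)
  then obtain m where m: "\<And>x. x \<in> S \<Longrightarrow> \<bar>h 1 x\<bar> \<le> m"
    by (auto simp: bounded_iff)
  with False have m0: "m \<ge> 0" by (metis abs_ge_zero equals0I order_trans)
  have step: "\<bar>h (Suc n) x - h n x\<bar> \<le> m / 2 ^ n * w x" if "x \<in> S" for n x
    using that
  proof (induction n arbitrary: x)
    case 0
    have "\<bar>h 1 x\<bar> \<le> m * w x" using m[OF 0] mult_left_mono[OF assms(3)[OF 0] m0] by simp
    then show ?case by (simp add: h_def)
  next
    case (Suc n)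
    from contr[OF h_cont h_cont Suc.IH Suc.prems] show ?case by (simp add: h_Suc)
  qed
  have "uniformly_convergent_on S (\<lambda>n x. \<Sum>i<n. h (Suc i) x - h i x)"
  proof (rule Weierstrass_m_test')
    show "norm (h (Suc n) x - h n x) \<le> m * W * (1/2) ^ n" if "x \<in> S" for n x
    proof -
      have "m / 2 ^ n * w x \<le> m / 2 ^ n * W" by (intro mult_left_mono W that) (simp add: m0)
      then show ?thesis using step[OF that, of n] by (simp add: power_divide)
    qed
    show "summable (\<lambda>n. m * W * (1/2) ^ n)" by (intro summable_mult summable_geometric) simp
  qed
  moreover have "(\<lambda>n x. \<Sum>i<n. h (Suc i) x - h i x) = h"
  proof (intro ext)
    fix n x show "(\<Sum>i<n. h (Suc i) x - h i x) = h n x"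
      using sum_lessThan_telescope[of "\<lambda>i. h i x" n] by (simp add: h_def[of 0])
  qed
  ultimately have "uniformly_convergent_on S h" by simp
  then obtain f where lim: "uniform_limit S h f sequentially"
    by (auto simp: uniformly_convergent_on_def)
  have f_cont: "continuous_on S f"
    by (rule uniform_limit_theorem[OF _ lim]) (auto simp: h_cont)
  have "F f x = f x" if x: "x \<in> S" for x
  proof (rule LIMSEQ_unique)
    show "(\<lambda>n. h (Suc n) x) \<longlonglongrightarrow> f x"
      using tendsto_uniform_limitI[OF lim x] by (rule LIMSEQ_Suc)
    show "(\<lambda>n. h (Suc n) x) \<longlonglongrightarrow> F f x"
    proof (rule tendstoI)
      fix e :: real assume e: "e > 0"
      have W1: "W \<ge> 1" using W[OF x] assms(3)[OF x] by simp
      have "\<forall>\<^sub>F n in sequentially. \<forall>y\<in>S. dist (h n y) (f y) < e / W"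
        using uniform_limitD[OF lim, of "e / W"] e W1 by simp
      then show "\<forall>\<^sub>F n in sequentially. dist (h (Suc n) x) (F f x) < e"
      proof eventually_elim
        case (elim n)
        have "\<bar>h n y - f y\<bar> \<le> e / W * w y" if "y \<in> S" for y
        proof -
          have "e / W * 1 \<le> e / W * w y" by (intro mult_left_mono assms(3) that) (use e W1 in simp)
          then show ?thesis using elim that by (auto simp: dist_real_def less_le intro: order_trans)
        qed
        from contr[OF h_cont f_cont this x] have "\<bar>h (Suc n) x - F f x\<bar> \<le> e / W / 2 * w x"
          by (simp add: h_Suc)
        also have "\<dots> \<le> e / W / 2 * W" by (intro mult_left_mono W x) (use e W1 in simp)
        also have "\<dots> < e" using e W1 by simp
        finally show ?case by (simp add: dist_real_def)
      qed
    qed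
  qed
  with f_cont show thesis by (rule that)
qed

lemma DERIV_unique_within_Icc:
  assumes "(f has_real_derivative d) (at x within {a..b})" "(f has_real_derivative d') (at x within {a..b})"
    and "a < b" "x \<in> {a..b}"
  shows "d = d'"
  using vector_derivative_unique_within_closed_interval[of a b x f d d'] assms
  by (simp add: has_real_derivative_iff_has_vector_derivative box_real)

lemma exp_diff_le:
  fixes a b c :: real
  assumes "a \<le> c" "b \<le> c"
  shows "\<bar>exp a - exp b\<bar> \<le> exp c * \<bar>a - b\<bar>"
proof -
  have "norm (exp a - exp b) \<le> exp c * norm (a - b)"
    by (rule field_differentiable_bound[where S="{..c}" and f'=exp])
       (use assms in \<open>auto intro!: derivative_eq_intros\<close>)
  then show ?thesis by simp
qed

section \<open>Relaxed solutions and their characteristics\<close>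

locale bounded_drift =
  fixes K k :: "real \<Rightarrow> real" and L L' \<Phi> :: real
  assumes K_deriv: "(K has_real_derivative k x) (at x)"
    and k_bound: "\<bar>k x\<bar> \<le> L"
    and k_lipschitz: "\<bar>k x - k y\<bar> \<le> L' * \<bar>x - y\<bar>"
begin

lemma L_nonneg: "L \<ge> 0"
  using k_bound[of 0] by linarith

lemma L'_nonneg: "L' \<ge> 0"
  using k_lipschitz[of 1 0] by simp

lemma continuous_on_k [continuous_intros]:
  assumes "continuous_on S f" shows "continuous_on S (\<lambda>x. k (f x))"
proof -
  have "L'-lipschitz_on UNIV k"
    using k_lipschitz L'_nonneg by (intro lipschitz_onI) (auto simp: dist_real_def)
  then have "continuous_on UNIV k" by (rule lipschitz_on_continuous_on)
  from continuous_on_compose2[OF this assms] show ?thesis by simp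
qed

lemma continuous_on_K [continuous_intros]:
  assumes "continuous_on S f" shows "continuous_on S (\<lambda>x. K (f x))"
proof -
  have "continuous_on UNIV K"
    using K_deriv by (auto intro!: DERIV_continuous_on)
  from continuous_on_compose2[OF this assms] show ?thesis by simp
qed

text \<open>
  System (S) with \<open>1 / N\<close> replaced by \<open>P(\<tau>, 1) - K(\<Phi>)\<close>, whose sign is left free, on a closed time interval and with
  the equation required up to the boundary. The initial datum is not part of the notion: by \<open>Q(\<tau>, 0) = 0\<close> it is
  determined by \<open>P(0, \<cdot>)\<close>.
\<close>

definition relaxed_solution :: "real \<Rightarrow> (real \<Rightarrow> real \<Rightarrow> real) \<Rightarrow> (real \<Rightarrow> real \<Rightarrow> real) \<Rightarrow> bool" where
  "relaxed_solution T Q P \<longleftrightarrow>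
     continuous_on ({0..T} \<times> {0..1}) (\<lambda>(\<tau>, \<eta>). P \<tau> \<eta>) \<and>
     (\<forall>\<tau>\<in>{0..T}. Q \<tau> 0 = 0) \<and>
     (\<forall>\<tau>\<in>{0..T}. \<forall>\<eta>\<in>{0..1}. (Q \<tau> has_real_derivative P \<tau> \<eta>) (at \<eta> within {0..1})) \<and>
     (\<forall>\<tau>\<in>{0..T}. \<forall>\<eta>\<in>{0..1}.
        ((\<lambda>s. Q s \<eta>) has_real_derivative P \<tau> 1 - K \<Phi> + K (Q \<tau> \<eta>) - P \<tau> \<eta>) (at \<tau> within {0..T}))"

context
  fixes T Q P
  assumes sol: "relaxed_solution T Q P"
begin

lemma P_cont: "continuous_on ({0..T} \<times> {0..1}) (\<lambda>(\<tau>, \<eta>). P \<tau> \<eta>)"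
  and Q_zero: "\<And>\<tau>. \<tau> \<in> {0..T} \<Longrightarrow> Q \<tau> 0 = 0"
  and Q_eta: "\<And>\<tau> \<eta>. \<tau> \<in> {0..T} \<Longrightarrow> \<eta> \<in> {0..1} \<Longrightarrow> (Q \<tau> has_real_derivative P \<tau> \<eta>) (at \<eta> within {0..1})"
  and Q_tau: "\<And>\<tau> \<eta>. \<tau> \<in> {0..T} \<Longrightarrow> \<eta> \<in> {0..1} \<Longrightarrow>
     ((\<lambda>s. Q s \<eta>) has_real_derivative P \<tau> 1 - K \<Phi> + K (Q \<tau> \<eta>) - P \<tau> \<eta>) (at \<tau> within {0..T})"
  using sol by (auto simp: relaxed_solution_def)

lemma continuous_on_P:
  assumes "continuous_on S a" "continuous_on S b" "a ` S \<subseteq> {0..T}" "b ` S \<subseteq> {0..1}"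
  shows "continuous_on S (\<lambda>x. P (a x) (b x))"
proof -
  have "continuous_on S (\<lambda>x. (a x, b x))" by (intro continuous_intros assms)
  moreover have "(\<lambda>x. (a x, b x)) ` S \<subseteq> {0..T} \<times> {0..1}" using assms(3,4) by fast
  ultimately show ?thesis using continuous_on_compose2[OF P_cont, of S "\<lambda>x. (a x, b x)"] by simp
qed

lemma continuous_on_Q:
  assumes "continuous_on S a" "continuous_on S b" "a ` S \<subseteq> {0..T}" "b ` S \<subseteq> {0..1}"
  shows "continuous_on S (\<lambda>x. Q (a x) (b x))"
proof -
  have 1: "continuous_on ({0..T} \<times> {0..1}) (\<lambda>(\<tau>, \<eta>). Q \<tau> \<eta>)"
  proof (rule has_derivative_continuous_on)
    fix z :: "real \<times> real" assume "z \<in> {0..T} \<times> {0..1}"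
    then show "((\<lambda>(\<tau>, \<eta>). Q \<tau> \<eta>) has_derivative
        (\<lambda>(s, t). (P (fst z) 1 - K \<Phi> + K (Q (fst z) (snd z)) - P (fst z) (snd z)) * s + P (fst z) (snd z) * t))
        (at z within {0..T} \<times> {0..1})"
      using has_derivative_real_partials[where f=Q and x="fst z" and y="snd z", OF Q_tau Q_eta P_cont]
      by auto
  qed
  have 2: "continuous_on S (\<lambda>x. (a x, b x))" by (intro continuous_intros assms)
  have "(\<lambda>x. (a x, b x)) ` S \<subseteq> {0..T} \<times> {0..1}" using assms(3,4) by fast
  from continuous_on_compose2[OF 1 2 this] show ?thesis by simp
qed

text \<open>
  At \<open>\<eta> = 0\<close> the time derivative of \<open>Q\<close> vanishes, and the equation reduces to a relation between the two boundary
  values of \<open>P\<close>.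
\<close>

lemma reentry:
  assumes "\<tau> \<in> {0..T}" "T > 0"
  shows "P \<tau> 0 = P \<tau> 1 - K \<Phi> + K 0"
proof -
  have "((\<lambda>s. Q s 0) has_real_derivative 0) (at \<tau> within {0..T})"
    by (rule has_field_derivative_transform_within[OF DERIV_const[of 0], of 1])
       (use Q_zero assms in auto)
  moreover have "((\<lambda>s. Q s 0) has_real_derivative P \<tau> 1 - K \<Phi> + K 0 - P \<tau> 0) (at \<tau> within {0..T})"
    using Q_tau[of \<tau> 0] Q_zero assms by simp
  ultimately have "0 = P \<tau> 1 - K \<Phi> + K 0 - P \<tau> 0"
    by (rule DERIV_unique_within_Icc) (use assms in auto)
  then show ?thesis by simp
qed

lemma Q_along_characteristic:
  assumes "0 \<le> \<tau>" "0 \<le> h" "\<tau> + h \<le> T" "0 \<le> \<eta>" "\<eta> + h \<le> 1"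
  shows "Q (\<tau> + h) (\<eta> + h) = Q \<tau> \<eta> +
    integral {0..h} (\<lambda>u. P (\<tau> + u) 1 - K \<Phi> + K (Q (\<tau> + u) (\<eta> + u)))"
proof -
  have "((\<lambda>u. Q (\<tau> + u) (\<eta> + u)) has_vector_derivative
      P (\<tau> + u) 1 - K \<Phi> + K (Q (\<tau> + u) (\<eta> + u))) (at u within {0..h})" if "u \<in> {0..h}" for u
  proof -
    have "((\<lambda>u. Q (\<tau> + u) (\<eta> + u)) has_real_derivative
      (P (\<tau> + u) 1 - K \<Phi> + K (Q (\<tau> + u) (\<eta> + u)) - P (\<tau> + u) (\<eta> + u)) * 1 + P (\<tau> + u) (\<eta> + u) * 1) (at u within {0..h})"
      by (rule has_real_derivative_along_path[where X="{0..T}" and Y="{0..1}" and ?f2.0=P])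
         (use assms that Q_tau Q_eta P_cont in \<open>auto intro!: derivative_eq_intros\<close>)
    then show ?thesis by (simp add: has_real_derivative_iff_has_vector_derivative)
  qed
  from fundamental_theorem_of_calculus[OF assms(2) this] show ?thesis
    by (simp add: integral_unique)
qed

text \<open>
  Formally this is the derivative of the equation with respect to \<open>\<eta>\<close>, but \<open>P\<close> need not be
  differentiable. Integrating along characteristics first, and differentiating the result in the label of the
  characteristic, uses only that \<open>Q\<close> is \<open>C\<^sup>1\<close>. The restriction \<open>h < 1\<close> leaves an
  interval of labels to differentiate on.
\<close>

lemma P_along_characteristic:
  assumes "0 \<le> \<tau>" "0 \<le> h" "\<tau> + h \<le> T" "0 \<le> \<eta>" "\<eta> + h \<le> 1" "h < 1"
  shows "P (\<tau> + h) (\<eta> + h) = P \<tau> \<eta> +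
    integral {0..h} (\<lambda>u. k (Q (\<tau> + u) (\<eta> + u)) * P (\<tau> + u) (\<eta> + u))"
proof -
  define U where "U = {0..1 - h}"
  have \<eta>: "\<eta> \<in> U" using assms by (simp add: U_def)
  have "((\<lambda>y. Q (\<tau> + h) (y + h)) has_real_derivative P (\<tau> + h) (\<eta> + h) * 1) (at \<eta> within U)"
  proof (rule DERIV_image_chain[where g="\<lambda>y. y + h" and f="Q (\<tau> + h)", unfolded o_def])
    have "(\<lambda>y. y + h) ` U \<subseteq> {0..1}" using assms by (auto simp: U_def)
    then show "(Q (\<tau> + h) has_real_derivative P (\<tau> + h) (\<eta> + h)) (at (\<eta> + h) within (\<lambda>y. y + h) ` U)"
      using Q_eta[of "\<tau> + h" "\<eta> + h"] assms by (auto intro: has_field_derivative_subset)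
  qed (auto intro!: derivative_eq_intros)
  moreover have "((\<lambda>y. Q (\<tau> + h) (y + h)) has_real_derivative
     P \<tau> \<eta> + integral (cbox 0 h) (\<lambda>u. k (Q (\<tau> + u) (\<eta> + u)) * P (\<tau> + u) (\<eta> + u))) (at \<eta> within U)"
  proof (rule has_field_derivative_transform_within[OF _ zero_less_one \<eta>])
    show "((\<lambda>y. Q \<tau> y + integral (cbox 0 h) (\<lambda>u. P (\<tau> + u) 1 - K \<Phi> + K (Q (\<tau> + u) (y + u)))) has_real_derivative
     P \<tau> \<eta> + integral (cbox 0 h) (\<lambda>u. k (Q (\<tau> + u) (\<eta> + u)) * P (\<tau> + u) (\<eta> + u))) (at \<eta> within U)"
    proof (intro DERIV_add leibniz_rule_field_derivative)
      show "(Q \<tau> has_real_derivative P \<tau> \<eta>) (at \<eta> within U)"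
        by (rule has_field_derivative_subset[OF Q_eta]) (use assms in \<open>auto simp: U_def\<close>)
      show "continuous_on (U \<times> cbox 0 h) (\<lambda>(y, u). k (Q (\<tau> + u) (y + u)) * P (\<tau> + u) (y + u))"
        unfolding case_prod_unfold
        by (intro continuous_intros continuous_on_P continuous_on_Q) (use assms in \<open>auto simp: U_def\<close>)
      show "(\<lambda>u. P (\<tau> + u) 1 - K \<Phi> + K (Q (\<tau> + u) (y + u))) integrable_on cbox 0 h" if "y \<in> U" for y
        unfolding box_real
        by (intro integrable_continuous_real continuous_intros continuous_on_P continuous_on_Q)
           (use assms that in \<open>auto simp: U_def\<close>)
      show "((\<lambda>y. P (\<tau> + u) 1 - K \<Phi> + K (Q (\<tau> + u) (y + u))) has_real_derivative
          k (Q (\<tau> + u) (y + u)) * P (\<tau> + u) (y + u)) (at y within U)" if "y \<in> U" "u \<in> cbox 0 h" for y u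
      proof -
        have "((\<lambda>y. Q (\<tau> + u) (y + u)) has_real_derivative P (\<tau> + u) (y + u) * 1) (at y within U)"
        proof (rule DERIV_image_chain[where g="\<lambda>y. y + u" and f="Q (\<tau> + u)", unfolded o_def])
          have "(\<lambda>y. y + u) ` U \<subseteq> {0..1}" using assms that by (auto simp: U_def)
          then show "(Q (\<tau> + u) has_real_derivative P (\<tau> + u) (y + u)) (at (y + u) within (\<lambda>y. y + u) ` U)"
            using Q_eta[of "\<tau> + u" "y + u"] assms that by (auto simp: U_def intro: has_field_derivative_subset)
        qed (auto intro!: derivative_eq_intros)
        from DERIV_chain2[OF K_deriv this] show ?thesis
          by (auto intro!: derivative_eq_intros)
      qed
    qed (use \<eta> in \<open>auto simp: U_def\<close>)
    show "Q \<tau> y + integral (cbox 0 h) (\<lambda>u. P (\<tau> + u) 1 - K \<Phi> + K (Q (\<tau> + u) (y + u))) = Q (\<tau> + h) (y + h)"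
      if "y \<in> U" for y
      using Q_along_characteristic[of \<tau> h y] assms that by (simp add: U_def)
  qed
  ultimately show ?thesis
    using DERIV_unique_within_Icc[of "\<lambda>y. Q (\<tau> + h) (y + h)" "P (\<tau> + h) (\<eta> + h) * 1" \<eta> 0 "1 - h"] \<eta> assms(6)
    by (simp add: U_def)
qed

lemma relaxed_solution_restrict:
  assumes "T' \<le> T" shows "relaxed_solution T' Q P"
  unfolding relaxed_solution_def
proof (intro conjI ballI)
  show "continuous_on ({0..T'} \<times> {0..1}) (\<lambda>(\<tau>, \<eta>). P \<tau> \<eta>)"
    by (rule continuous_on_subset[OF P_cont]) (use assms in auto)
  fix \<tau> \<eta> :: real assume "\<tau> \<in> {0..T'}" "\<eta> \<in> {0..1}"
  then show "((\<lambda>s. Q s \<eta>) has_real_derivative P \<tau> 1 - K \<Phi> + K (Q \<tau> \<eta>) - P \<tau> \<eta>) (at \<tau> within {0..T'})"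
    by (intro has_field_derivative_subset[OF Q_tau]) (use assms in auto)
qed (use assms Q_zero Q_eta in auto)

end

lemma Q_eq_integral:
  assumes sol: "relaxed_solution T Q P" and "\<tau> \<in> {0..T}" "\<eta> \<in> {0..1}"
  shows "Q \<tau> \<eta> = integral {0..\<eta>} (P \<tau>)"
proof -
  have "(P \<tau> has_integral Q \<tau> \<eta> - Q \<tau> 0) {0..\<eta>}"
  proof (rule fundamental_theorem_of_calculus)
    show "(Q \<tau> has_vector_derivative P \<tau> \<xi>) (at \<xi> within {0..\<eta>})" if "\<xi> \<in> {0..\<eta>}" for \<xi>
      using has_field_derivative_subset[OF Q_eta[OF sol, of \<tau> \<xi>], of "{0..\<eta>}"] assms that
      by (simp add: has_real_derivative_iff_has_vector_derivative)
  qed (use assms in auto)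
  then show ?thesis using Q_zero[OF sol assms(2)] by (simp add: integral_unique)
qed

lemma Q_diff_le:
  assumes sol1: "relaxed_solution T Q1 P1" and sol2: "relaxed_solution T Q2 P2"
    and s: "s \<in> {0..T}" and c: "\<And>x. x \<in> {0..1} \<Longrightarrow> \<bar>P1 s x - P2 s x\<bar> \<le> c" and x: "x \<in> {0..1}"
  shows "\<bar>Q1 s x - Q2 s x\<bar> \<le> c"
proof -
  have "norm ((Q1 s x - Q2 s x) - (Q1 s 0 - Q2 s 0)) \<le> c * norm (x - 0)"
  proof (rule field_differentiable_bound[where S="{0..1}" and f'="\<lambda>x. P1 s x - P2 s x"])
    show "((\<lambda>x. Q1 s x - Q2 s x) has_real_derivative P1 s z - P2 s z) (at z within {0..1})" if "z \<in> {0..1}" for z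
      by (intro DERIV_diff Q_eta[OF sol1] Q_eta[OF sol2] that s)
  qed (use x c in auto)
  also have "\<dots> \<le> c * 1"
    using order_trans[OF abs_ge_zero c[OF x]] x by (intro mult_left_mono) auto
  finally show ?thesis using Q_zero[OF sol1 s] Q_zero[OF sol2 s] by simp
qed

text \<open>
  Trace the characteristic back to where it started, at time \<open>0\<close> or at \<open>\<eta> = 0\<close>. There \<open>P\<close> is
  nonnegative, by hypothesis or by re-entry, and on the way it only gets multiplied by an exponential.
\<close>

lemma P_nonneg:
  assumes sol: "relaxed_solution T Q P" and "T > 0" "K \<Phi> \<ge> 0" "K 0 \<ge> 0"
    and init: "\<And>\<eta>. \<eta> \<in> {0..1} \<Longrightarrow> P 0 \<eta> \<ge> 0"
    and bdry: "\<And>\<tau>. \<tau> \<in> {0..T} \<Longrightarrow> P \<tau> 1 \<ge> K \<Phi>"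
    and \<tau>: "\<tau> \<in> {0..T}" and \<eta>: "\<eta> \<in> {0..1}"
  shows "P \<tau> \<eta> \<ge> 0"
proof (cases "\<eta> = 1")
  case True
  then show ?thesis using order_trans[OF assms(3) bdry[OF \<tau>]] by simp
next
  case False
  define h where "h = min \<tau> \<eta>"
  define a where "a u = P (\<tau> - h + u) (\<eta> - h + u)" for u
  define c where "c u = k (Q (\<tau> - h + u) (\<eta> - h + u))" for u
  have h: "0 \<le> h" "h \<le> \<tau>" "h \<le> \<eta>" "h < 1" using \<tau> \<eta> False by (auto simp: h_def)
  have a_cont: "continuous_on {0..h} a" and c_cont: "continuous_on {0..h} c"
    unfolding a_def c_def
    by (intro continuous_intros continuous_on_P[OF sol] continuous_on_Q[OF sol]; use h \<tau> \<eta> in auto)+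
  have a0: "a 0 \<ge> 0"
  proof (cases "h = \<tau>")
    case True
    then show ?thesis using init[of "\<eta> - h"] h \<eta> by (simp add: a_def)
  next
    case False
    then have "h = \<eta>" by (auto simp: h_def min_def split: if_splits)
    then show ?thesis using reentry[OF sol, of "\<tau> - h"] bdry[of "\<tau> - h"] assms h \<tau> by (simp add: a_def)
  qed
  have a_eq: "a u = a 0 + integral {0..u} (\<lambda>s. c s * a s)" if "u \<in> {0..h}" for u
    using P_along_characteristic[OF sol, of "\<tau> - h" u "\<eta> - h"] that h \<tau> \<eta> by (simp add: a_def c_def)
  define I where "I u = integral {0..u} c" for u
  have a_deriv: "(a has_real_derivative c u * a u) (at u within {0..h})" if "u \<in> {0..h}" for u
  proof (rule has_field_derivative_transform_within[OF _ zero_less_one that])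
    show "((\<lambda>u. a 0 + integral {0..u} (\<lambda>s. c s * a s)) has_real_derivative c u * a u) (at u within {0..h})"
      using integral_has_real_derivative[of 0 h "\<lambda>s. c s * a s" u] a_cont c_cont that
      by (auto intro!: derivative_eq_intros continuous_intros)
  qed (simp add: a_eq[symmetric])
  have I_deriv: "(I has_real_derivative c u) (at u within {0..h})" if "u \<in> {0..h}" for u
    unfolding I_def using integral_has_real_derivative[OF c_cont that] .
  have "\<exists>C. \<forall>u\<in>{0..h}. a u * exp (- I u) = C"
  proof (rule has_field_derivative_zero_constant)
    show "((\<lambda>u. a u * exp (- I u)) has_real_derivative 0) (at u within {0..h})" if "u \<in> {0..h}" for u
      by (auto intro!: derivative_eq_intros a_deriv I_deriv that)
  qed simp
  then have "a h * exp (- I h) = a 0 * exp (- I 0)" using h by (metis atLeastAtMost_iff order_refl)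
  then have "a h = a 0 * exp (I h)" by (simp add: I_def exp_minus field_simps)
  with a0 have "a h \<ge> 0" by simp
  then show ?thesis by (simp add: a_def)
qed

section \<open>Stability\<close>

text \<open>
  A maximum principle. Take a maximum point of \<open>exp (- \<lambda> \<tau>) \<bar>P\<^sub>1 - P\<^sub>2\<bar>\<close>. It can be assumed not to lie on
  \<open>\<eta> = 0\<close>, because re-entry gives both solutions the same jump. If it were at a positive time and the maximum not zero, one could
  go back along the characteristic for a short while; \<open>\<bar>P\<^sub>1 - P\<^sub>2\<bar>\<close> grows along it at a rate of at most
  \<open>L + L' B < \<lambda>\<close>, which contradicts maximality. Only one of the two solutions has to be bounded by \<open>B\<close>,
  so the constant does not depend on the other one.
\<close>

lemma relaxed_solution_stability:
  assumes sol1: "relaxed_solution T Q1 P1" and sol2: "relaxed_solution T Q2 P2" and "T > 0"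
    and B: "\<And>\<tau> \<eta>. \<tau> \<in> {0..T} \<Longrightarrow> \<eta> \<in> {0..1} \<Longrightarrow> \<bar>P2 \<tau> \<eta>\<bar> \<le> B"
    and lam: "lam > L + L' * B"
    and init: "\<And>\<eta>. \<eta> \<in> {0..1} \<Longrightarrow> \<bar>P1 0 \<eta> - P2 0 \<eta>\<bar> \<le> m"
    and \<tau>: "\<tau> \<in> {0..T}" and \<eta>: "\<eta> \<in> {0..1}"
  shows "\<bar>P1 \<tau> \<eta> - P2 \<tau> \<eta>\<bar> \<le> m * exp (lam * \<tau>)"
proof -
  define R where "R = {0..T} \<times> {0..1::real}"
  define d where "d \<tau> \<eta> = P1 \<tau> \<eta> - P2 \<tau> \<eta>" for \<tau> \<eta>
  have "B \<ge> 0" using order_trans[OF abs_ge_zero B[of 0 0]] \<open>T > 0\<close> by simp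
  have lam0: "lam > 0" using lam L_nonneg mult_nonneg_nonneg[OF L'_nonneg \<open>B \<ge> 0\<close>] by linarith
  have cont: "continuous_on R (\<lambda>z. exp (- lam * fst z) * \<bar>d (fst z) (snd z)\<bar>)"
    unfolding d_def by (intro continuous_intros continuous_on_P[OF sol1] continuous_on_P[OF sol2]) (auto simp: R_def)
  have "compact R" unfolding R_def by (intro compact_Times compact_Icc)
  moreover have "R \<noteq> {}" using \<open>T > 0\<close> by (simp add: R_def)
  ultimately obtain z0 where z0: "z0 \<in> R"
      "\<And>z. z \<in> R \<Longrightarrow> exp (- lam * fst z) * \<bar>d (fst z) (snd z)\<bar> \<le> exp (- lam * fst z0) * \<bar>d (fst z0) (snd z0)\<bar>"
    using continuous_attains_sup[OF _ _ cont] by blast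
  define M where "M = exp (- lam * fst z0) * \<bar>d (fst z0) (snd z0)\<bar>"
  define t where "t = fst z0"
  \<comment> \<open>re-entry: the value at \<open>\<eta> = 0\<close> can be read off at \<open>\<eta> = 1\<close>, where going back in time is possible\<close>
  define y where "y = (if snd z0 = 0 then 1 else snd z0)"
  have ty: "t \<in> {0..T}" "y \<in> {0<..1}" using z0(1) by (auto simp: R_def t_def y_def)
  have "d t 0 = d t 1"
    using reentry[OF sol1, of t] reentry[OF sol2, of t] ty \<open>T > 0\<close> by (simp add: d_def)
  then have M_eq: "\<bar>d t y\<bar> = M * exp (lam * t)"
    by (auto simp: M_def t_def y_def exp_minus field_simps)
  have d_le: "\<bar>d s x\<bar> \<le> M * exp (lam * s)" if "s \<in> {0..T}" "x \<in> {0..1}" for s x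
    using z0(2)[of "(s, x)"] that by (auto simp: M_def R_def exp_minus field_simps)
  have M0: "M \<ge> 0" by (simp add: M_def)
  have Q_le: "\<bar>Q1 s x - Q2 s x\<bar> \<le> M * exp (lam * s)" if "s \<in> {0..T}" "x \<in> {0..1}" for s x
    using Q_diff_le[OF sol1 sol2, of s "M * exp (lam * s)" x] d_le that by (simp add: d_def)
  have "M \<le> m"
  proof (cases "t = 0")
    case True
    then show ?thesis using init[of y] M_eq ty by (simp add: d_def)
  next
    case False
    define h where "h = min t y / 2"
    have h: "0 < h" "h < t" "h < y" "h < 1" using False ty by (auto simp: h_def min_def field_simps)
    define s where "s u = t - h + u" for u
    define x where "x u = y - h + u" for u
    have sx: "s u \<in> {0..T}" "x u \<in> {0..1}" if "u \<in> {0..h}" for u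
      using that h ty by (auto simp: s_def x_def)
    define g where "g u = k (Q1 (s u) (x u)) * P1 (s u) (x u) - k (Q2 (s u) (x u)) * P2 (s u) (x u)" for u
    define C where "C = L + L' * B"
    have int: "(\<lambda>u. k (Q1 (s u) (x u)) * P1 (s u) (x u)) integrable_on {0..h}"
              "(\<lambda>u. k (Q2 (s u) (x u)) * P2 (s u) (x u)) integrable_on {0..h}"
      using sx unfolding s_def x_def
      by (auto intro!: integrable_continuous_real continuous_intros continuous_on_P[OF sol1] continuous_on_P[OF sol2]
          continuous_on_Q[OF sol1] continuous_on_Q[OF sol2])
    have "d t y = d (t - h) (y - h) + integral {0..h} g"
      using P_along_characteristic[OF sol1, of "t - h" h "y - h"] P_along_characteristic[OF sol2, of "t - h" h "y - h"]
        h ty int by (simp add: d_def g_def[abs_def] integral_diff s_def x_def)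
    moreover have "\<bar>integral {0..h} g\<bar> \<le> C / lam * (M * (exp (lam * t) - exp (lam * (t - h))))"
    proof -
      have g_le: "norm (g u) \<le> C * M * exp (lam * s u)" if "u \<in> {0..h}" for u
      proof -
        have "g u = k (Q1 (s u) (x u)) * d (s u) (x u) + (k (Q1 (s u) (x u)) - k (Q2 (s u) (x u))) * P2 (s u) (x u)"
          by (simp add: g_def d_def algebra_simps)
        also have "\<bar>\<dots>\<bar> \<le> \<bar>k (Q1 (s u) (x u))\<bar> * \<bar>d (s u) (x u)\<bar> + \<bar>k (Q1 (s u) (x u)) - k (Q2 (s u) (x u))\<bar> * \<bar>P2 (s u) (x u)\<bar>"
          by (metis abs_mult abs_triangle_ineq)
        also have "\<dots> \<le> L * (M * exp (lam * s u)) + (L' * (M * exp (lam * s u))) * B"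
          by (intro add_mono mult_mono k_bound order_trans[OF k_lipschitz] mult_left_mono)
             (use sx[OF that] d_le Q_le B L_nonneg L'_nonneg M0 in auto)
        finally show ?thesis by (simp add: C_def algebra_simps)
      qed
      have 1: "((\<lambda>u. C * M * exp (lam * s u)) has_integral
          (C * M / lam * exp (lam * s h) - C * M / lam * exp (lam * s 0))) {0..h}"
        using lam0 h unfolding s_def
        by (intro fundamental_theorem_of_calculus)
           (auto intro!: derivative_eq_intros simp: has_real_derivative_iff_has_vector_derivative[symmetric])
      have "norm (integral {0..h} g) \<le> integral {0..h} (\<lambda>u. C * M * exp (lam * s u))"
      proof (rule integral_norm_bound_integral)
        show "g integrable_on {0..h}" unfolding g_def[abs_def] by (intro integrable_diff int)
        show "(\<lambda>u. C * M * exp (lam * s u)) integrable_on {0..h}" using 1 by (rule has_integral_integrable)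
      qed (rule g_le)
      also have "\<dots> = C * M / lam * exp (lam * s h) - C * M / lam * exp (lam * s 0)"
        using 1 by (rule integral_unique)
      finally show ?thesis by (simp add: s_def algebra_simps)
    qed
    moreover have "\<bar>d (t - h) (y - h)\<bar> \<le> M * exp (lam * (t - h))"
      by (rule d_le) (use h ty in auto)
    ultimately have le: "M * exp (lam * t) \<le> M * exp (lam * (t - h)) + C / lam * (M * (exp (lam * t) - exp (lam * (t - h))))"
      unfolding M_eq[symmetric] by linarith
    define E where "E = exp (lam * t) - exp (lam * (t - h))"
    have E: "E > 0" using lam0 h by (simp add: E_def)
    have "M * (E * (1 - C / lam)) \<le> 0" using le by (simp add: E_def algebra_simps)
    moreover have "E * (1 - C / lam) > 0" using E lam lam0 by (simp add: C_def)
    ultimately have "M \<le> 0" by (metis mult_pos_pos not_le)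
    moreover have "m \<ge> 0" using order_trans[OF abs_ge_zero init[of 0]] by simp
    ultimately show ?thesis by simp
  qed
  then have "M * exp (lam * \<tau>) \<le> m * exp (lam * \<tau>)" by simp
  with d_le[OF \<tau> \<eta>] show ?thesis unfolding d_def by (rule order_trans)
qed

section \<open>Existence on a unit time interval\<close>

text \<open>
  In Lagrangian coordinates \<open>x = \<eta> - \<tau>\<close> the equation for \<open>P\<close> becomes an ordinary differential equation
  in \<open>\<tau>\<close> for each \<open>x\<close>, with the rate \<open>K'(Q)\<close>. Clamping the arguments to the unit square extends the rate
  continuously to characteristics that have not yet entered the strip or have already left it. All characteristics then live on the
  fixed rectangle \<open>[0,1] \<times> [-1,1]\<close>, and differentiating integrals over \<open>x\<close> becomes elementary.
\<close>

definition rate :: "(real \<times> real \<Rightarrow> real) \<Rightarrow> real \<Rightarrow> real \<Rightarrow> real" where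
  "rate f t y = k (f (max 0 (min 1 t), max 0 (min 1 y)))"

definition growth :: "(real \<times> real \<Rightarrow> real) \<Rightarrow> real \<Rightarrow> real \<Rightarrow> real" where
  "growth f \<tau> x = integral {0..\<tau>} (\<lambda>t. rate f t (x + t))"

text \<open>
  The value at time \<open>0\<close> of the characteristic \<open>x\<close>. For \<open>x < 0\<close> it is fictitious: the characteristic enters
  at time \<open>- x\<close>, and the value is chosen such that at that time the re-entry relation holds with
  the characteristic \<open>1 + x\<close>, which leaves at the same moment.
\<close>

definition launch :: "(real \<Rightarrow> real) \<Rightarrow> (real \<times> real \<Rightarrow> real) \<Rightarrow> real \<Rightarrow> real" where
  "launch p f x = (if 0 \<le> x then p x
     else (p (1 + x) * exp (growth f (-x) (1 + x)) - (K \<Phi> - K 0)) / exp (growth f (-x) x))"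

definition slope :: "(real \<Rightarrow> real) \<Rightarrow> (real \<times> real \<Rightarrow> real) \<Rightarrow> real \<Rightarrow> real \<Rightarrow> real" where
  "slope p f \<tau> x = launch p f x * exp (growth f \<tau> x)"

text \<open>
  The antiderivative in \<open>\<eta>\<close> of the slope along the strip: the function \<open>Q\<close> that results when the growth rate
  \<open>K'(Q)\<close> is replaced by \<open>K'(f)\<close>.
\<close>

definition picard :: "(real \<Rightarrow> real) \<Rightarrow> (real \<times> real \<Rightarrow> real) \<Rightarrow> real \<times> real \<Rightarrow> real" where
  "picard p f z = integral {0..snd z} (\<lambda>\<xi>. slope p f (fst z) (\<xi> - fst z))"

lemma rate_bound: "\<bar>rate f t y\<bar> \<le> L"
  by (simp add: rate_def k_bound)

context
  fixes f :: "real \<times> real \<Rightarrow> real"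
  assumes f: "continuous_on ({0..1} \<times> {0..1}) f"
begin

lemma continuous_on_rate:
  assumes "continuous_on S a" "continuous_on S b"
  shows "continuous_on S (\<lambda>z. rate f (a z) (b z))"
  unfolding rate_def
  by (intro continuous_intros continuous_on_compose2[OF f] assms) auto

lemma continuous_on_growth:
  fixes a b :: "'z::topological_space \<Rightarrow> real"
  assumes "continuous_on S a" "continuous_on S b" "a ` S \<subseteq> {0..1}"
  shows "continuous_on S (\<lambda>z. growth f (a z) (b z))"
  unfolding growth_def
proof (rule continuous_on_integral_upto[where c=1])
  show "continuous_on (S \<times> {0..1}) (\<lambda>(z, t). rate f t (b z + t))"
    unfolding case_prod_unfold
    by (intro continuous_on_rate continuous_intros continuous_on_compose2[OF assms(2)]) auto
qed (use assms in auto)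

lemma growth_bound:
  assumes "\<tau> \<in> {0..1}"
  shows "\<bar>growth f \<tau> x\<bar> \<le> L"
proof -
  have "norm (integral {0..\<tau>} (\<lambda>t. rate f t (x + t))) \<le> L * (\<tau> - 0)"
    by (rule integral_bound) (use assms rate_bound in \<open>auto intro!: continuous_on_rate continuous_intros\<close>)
  also have "\<dots> \<le> L * 1" by (intro mult_left_mono) (use assms L_nonneg in auto)
  finally show ?thesis by (simp add: growth_def)
qed

lemma growth_deriv:
  assumes "\<tau> \<in> {0..1}"
  shows "((\<lambda>\<tau>. growth f \<tau> x) has_real_derivative rate f \<tau> (x + \<tau>)) (at \<tau> within {0..1})"
  unfolding growth_def
  by (rule integral_has_real_derivative) (use assms in \<open>auto intro!: continuous_on_rate continuous_intros\<close>)

lemma growth_0 [simp]: "growth f 0 x = 0"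
  by (simp add: growth_def)

context
  fixes p :: "real \<Rightarrow> real"
  assumes p: "continuous_on {0..1} p" "p 1 - p 0 = K \<Phi> - K 0"
begin

text \<open>
  The two branches agree at \<open>x = 0\<close> exactly by the compatibility condition on the datum.
\<close>

lemma continuous_on_launch: "continuous_on {-1..1} (launch p f)"
proof -
  have "continuous_on ({-1..0} \<union> {0..1}) (\<lambda>x. if x \<in> {-1..0} then
      (p (1 + x) * exp (growth f (-x) (1 + x)) - (K \<Phi> - K 0)) / exp (growth f (-x) x) else p x)"
  proof (rule continuous_on_cases)
    show "continuous_on {-1..0} (\<lambda>x. (p (1 + x) * exp (growth f (- x) (1 + x)) - (K \<Phi> - K 0)) / exp (growth f (- x) x))"
      by (intro continuous_intros continuous_on_growth continuous_on_compose2[OF p(1)]) auto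
  qed (use p in auto)
  moreover have "{-1..0} \<union> {0..1} = {-1..1::real}" by auto
  ultimately have "continuous_on {-1..1} (\<lambda>x. if x \<in> {-1..0} then
      (p (1 + x) * exp (growth f (-x) (1 + x)) - (K \<Phi> - K 0)) / exp (growth f (-x) x) else p x)" by simp
  then show ?thesis
    by (rule continuous_on_eq) (use p(2) in \<open>auto simp: launch_def\<close>)
qed

lemma continuous_on_slope:
  assumes "continuous_on S a" "continuous_on S b" "a ` S \<subseteq> {0..1}" "b ` S \<subseteq> {-1..1}"
  shows "continuous_on S (\<lambda>z. slope p f (a z) (b z))"
  unfolding slope_def
  by (intro continuous_intros continuous_on_growth continuous_on_compose2[OF continuous_on_launch] assms)

lemma slope_deriv:
  assumes "\<tau> \<in> {0..1}"
  shows "((\<lambda>\<tau>. slope p f \<tau> x) has_real_derivative slope p f \<tau> x * rate f \<tau> (x + \<tau>)) (at \<tau> within {0..1})"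
  unfolding slope_def by (auto intro!: derivative_eq_intros growth_deriv assms)

lemma slope_reentry:
  assumes "\<tau> \<in> {0..1}"
  shows "slope p f \<tau> (- \<tau>) = slope p f \<tau> (1 - \<tau>) - (K \<Phi> - K 0)"
  using assms p(2) by (cases "\<tau> = 0") (auto simp: slope_def launch_def)

lemma continuous_on_picard: "continuous_on ({0..1} \<times> {0..1}) (picard p f)"
  unfolding picard_def
proof (rule continuous_on_integral_upto[where c=1])
  show "continuous_on (({0..1} \<times> {0..1}) \<times> {0..1}) (\<lambda>(z, \<xi>). slope p f (fst z) (\<xi> - fst z))"
    unfolding case_prod_unfold by (intro continuous_on_slope continuous_intros) auto
qed (auto intro!: continuous_intros)

lemma slope_before_launch:
  assumes "x < 0"
  shows "slope p f \<tau> x =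
    (p (1 + x) * exp (growth f (-x) (1 + x)) - (K \<Phi> - K 0)) * exp (growth f \<tau> x - growth f (-x) x)"
  using assms by (simp add: slope_def launch_def exp_diff)

end

end

text \<open>
  A perturbation of size \<open>m exp (\<lambda> t)\<close> of \<open>f\<close> enters only through time integrals of the rate, and integrating
  gains a factor \<open>1 / \<lambda>\<close>. The constant \<open>C\<close> collects the Lipschitz constants of the exponentials; its two
  summands come from the value of the leaving characteristic and from the growth after re-entry.
\<close>

lemma picard_contraction:
  assumes f: "continuous_on ({0..1} \<times> {0..1}) f" and g: "continuous_on ({0..1} \<times> {0..1}) g"
    and p: "continuous_on {0..1} p" "p 1 - p 0 = K \<Phi> - K 0"
    and B: "\<And>x. x \<in> {0..1} \<Longrightarrow> \<bar>p x\<bar> \<le> B"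
    and C: "C = B * exp L * exp (2 * L) + (B * exp L + \<bar>K \<Phi> - K 0\<bar>) * exp (2 * L) * 2"
    and lam: "lam \<ge> 2 * (C * L') + 1"
    and close: "\<And>z. z \<in> {0..1} \<times> {0..1} \<Longrightarrow> \<bar>f z - g z\<bar> \<le> m * exp (lam * fst z)"
    and z: "z \<in> {0..1} \<times> {0..1}"
  shows "\<bar>picard p f z - picard p g z\<bar> \<le> m / 2 * exp (lam * fst z)"
proof -
  have B0: "B \<ge> 0" using order_trans[OF abs_ge_zero B[of 0]] by simp
  have m0: "m \<ge> 0" using order_trans[OF abs_ge_zero close[of "(0, 0)"]] by simp
  have C_ge: "C \<ge> B * exp L"
  proof -
    have "B * exp L * 1 \<le> B * exp L * exp (2 * L)" using B0 L_nonneg by (intro mult_left_mono) auto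
    moreover have "0 \<le> (B * exp L + \<bar>K \<Phi> - K 0\<bar>) * exp (2 * L) * 2" using B0 by simp
    ultimately show ?thesis unfolding C by linarith
  qed
  have C0: "C \<ge> 0" using C_ge B0 by (meson exp_ge_zero mult_nonneg_nonneg order_trans)
  have lam0: "lam > 0" using lam mult_nonneg_nonneg[OF C0 L'_nonneg] by linarith
  define D where "D \<tau> = L' * m / lam * exp (lam * \<tau>)" for \<tau>
  have D0: "D \<tau> \<ge> 0" for \<tau> using L'_nonneg m0 lam0 by (simp add: D_def)
  have growth_diff: "\<bar>growth f \<tau> x - growth g \<tau> x\<bar> \<le> D \<tau>" if "\<tau> \<in> {0..1}" for \<tau> x
  proof -
    have int: "(\<lambda>t. rate f t (x + t)) integrable_on {0..\<tau>}" "(\<lambda>t. rate g t (x + t)) integrable_on {0..\<tau>}"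
      by (auto intro!: integrable_continuous_real continuous_on_rate[OF f] continuous_on_rate[OF g] continuous_intros)
    have 1: "((\<lambda>t. L' * m * exp (lam * t)) has_integral (D \<tau> - D 0)) {0..\<tau>}"
      unfolding D_def using lam0 that
      by (intro fundamental_theorem_of_calculus)
         (auto intro!: derivative_eq_intros simp: has_real_derivative_iff_has_vector_derivative[symmetric])
    have "norm (integral {0..\<tau>} (\<lambda>t. rate f t (x + t) - rate g t (x + t))) \<le> integral {0..\<tau>} (\<lambda>t. L' * m * exp (lam * t))"
    proof (rule integral_norm_bound_integral)
      show "norm (rate f t (x + t) - rate g t (x + t)) \<le> L' * m * exp (lam * t)" if t: "t \<in> {0..\<tau>}" for t
      proof -
        have tt: "max 0 (min 1 t) = t" using t \<open>\<tau> \<in> {0..1}\<close> by auto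
        define y where "y = max 0 (min 1 (x + t))"
        have "norm (rate f t (x + t) - rate g t (x + t)) \<le> L' * \<bar>f (t, y) - g (t, y)\<bar>"
          using k_lipschitz by (simp add: rate_def tt y_def)
        also have "\<dots> \<le> L' * (m * exp (lam * t))"
          using close[of "(t, y)"] t \<open>\<tau> \<in> {0..1}\<close> L'_nonneg by (intro mult_left_mono) (auto simp: y_def)
        finally show ?thesis by (simp add: mult.assoc)
      qed
    qed (use 1 int in \<open>auto intro: integrable_diff\<close>)
    also have "\<dots> = D \<tau> - D 0" using 1 by (rule integral_unique)
    also have "\<dots> \<le> D \<tau>" using D0 by simp
    finally show ?thesis by (simp add: growth_def integral_diff[OF int])
  qed
  have slope_diff: "\<bar>slope p f \<tau> x - slope p g \<tau> x\<bar> \<le> C * D \<tau>"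
    if \<tau>: "\<tau> \<in> {0..1}" and x: "- \<tau> \<le> x" "x \<le> 1 - \<tau>" for \<tau> x
  proof (cases "0 \<le> x")
    case True
    have "\<bar>slope p f \<tau> x - slope p g \<tau> x\<bar> = \<bar>p x\<bar> * \<bar>exp (growth f \<tau> x) - exp (growth g \<tau> x)\<bar>"
      using True by (simp add: slope_def launch_def flip: abs_mult right_diff_distrib)
    also have "\<dots> \<le> B * (exp L * D \<tau>)"
      using B[of x] \<tau> x True B0 growth_bound[OF f \<tau>, of x] growth_bound[OF g \<tau>, of x]
      by (intro mult_mono order_trans[OF exp_diff_le[where c=L]] growth_diff mult_left_mono) auto
    also have "\<dots> \<le> C * D \<tau>" using mult_right_mono[OF C_ge D0[of \<tau>]] by (simp add: mult.assoc)
    finally show ?thesis .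
  next
    case False
    define a where "a h = p (1 + x) * exp (growth h (-x) (1 + x)) - (K \<Phi> - K 0)" for h
    define e where "e h = growth h \<tau> x - growth h (-x) x" for h
    have x': "-x \<in> {0..1}" "1 + x \<in> {0..1}" using False x \<tau> by auto
    have p1: "\<bar>p (1 + x)\<bar> \<le> B" using B[of "1 + x"] x' by simp
    have D_mono: "D (-x) \<le> D \<tau>"
      unfolding D_def using mult_left_mono[of "-x" \<tau> lam] x lam0 L'_nonneg m0 by (intro mult_left_mono) auto
    have e_le: "\<bar>e f\<bar> \<le> 2 * L" "\<bar>e g\<bar> \<le> 2 * L" "\<bar>e f - e g\<bar> \<le> 2 * D \<tau>"
      using growth_bound[OF f \<tau>, of x] growth_bound[OF f x'(1), of x] growth_bound[OF g \<tau>, of x]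
        growth_bound[OF g x'(1), of x] growth_diff[OF \<tau>, of x] growth_diff[OF x'(1), of x] D_mono
      unfolding e_def by linarith+
    have ea: "\<bar>exp (e f) - exp (e g)\<bar> \<le> exp (2 * L) * (2 * D \<tau>)"
      using e_le by (intro order_trans[OF exp_diff_le[where c="2 * L"]] mult_left_mono) auto
    have "\<bar>a f - a g\<bar> = \<bar>p (1 + x)\<bar> * \<bar>exp (growth f (-x) (1 + x)) - exp (growth g (-x) (1 + x))\<bar>"
      by (simp add: a_def flip: abs_mult right_diff_distrib)
    also have "\<dots> \<le> B * (exp L * D \<tau>)"
      using p1 B0 growth_bound[OF f x'(1), of "1 + x"] growth_bound[OF g x'(1), of "1 + x"] order_trans[OF growth_diff[OF x'(1)] D_mono]
      by (intro mult_mono order_trans[OF exp_diff_le[where c=L]] mult_left_mono) auto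
    finally have a1: "\<bar>a f - a g\<bar> \<le> B * (exp L * D \<tau>)" .
    have "\<bar>a g\<bar> \<le> \<bar>p (1 + x) * exp (growth g (-x) (1 + x))\<bar> + \<bar>K \<Phi> - K 0\<bar>"
      unfolding a_def by (rule abs_triangle_ineq4)
    also have "\<dots> \<le> B * exp L + \<bar>K \<Phi> - K 0\<bar>"
      unfolding abs_mult using p1 B0 growth_bound[OF g x'(1), of "1 + x"] by (intro add_mono mult_mono) auto
    finally have a2: "\<bar>a g\<bar> \<le> B * exp L + \<bar>K \<Phi> - K 0\<bar>" .
    have "slope p f \<tau> x - slope p g \<tau> x = (a f - a g) * exp (e f) + a g * (exp (e f) - exp (e g))"
      using slope_before_launch[OF f p, of x \<tau>] slope_before_launch[OF g p, of x \<tau>] False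
      by (simp add: a_def e_def algebra_simps)
    also have "\<bar>\<dots>\<bar> \<le> \<bar>a f - a g\<bar> * \<bar>exp (e f)\<bar> + \<bar>a g\<bar> * \<bar>exp (e f) - exp (e g)\<bar>"
      by (metis abs_mult abs_triangle_ineq)
    also have "\<dots> \<le> (B * (exp L * D \<tau>)) * exp (2 * L) + (B * exp L + \<bar>K \<Phi> - K 0\<bar>) * (exp (2 * L) * (2 * D \<tau>))"
      using e_le B0 D0 by (intro add_mono mult_mono a1 a2 ea) auto
    also have "\<dots> = C * D \<tau>" by (simp add: C algebra_simps)
    finally show ?thesis .
  qed
  obtain \<tau> \<eta> where z_eq: "z = (\<tau>, \<eta>)" by (cases z)
  then have \<tau>: "\<tau> \<in> {0..1}" and \<eta>: "\<eta> \<in> {0..1}" using z by auto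
  have int: "(\<lambda>\<xi>. slope p f \<tau> (\<xi> - \<tau>)) integrable_on {0..\<eta>}" "(\<lambda>\<xi>. slope p g \<tau> (\<xi> - \<tau>)) integrable_on {0..\<eta>}"
    using \<tau> \<eta> by (auto intro!: integrable_continuous_real continuous_on_slope[OF f p] continuous_on_slope[OF g p] continuous_intros)
  have "norm (integral {0..\<eta>} (\<lambda>\<xi>. slope p f \<tau> (\<xi> - \<tau>) - slope p g \<tau> (\<xi> - \<tau>))) \<le> integral {0..\<eta>} (\<lambda>\<xi>. C * D \<tau>)"
    using \<eta> \<tau> by (intro integral_norm_bound_integral integrable_diff int) (auto intro!: slope_diff)
  then have "\<bar>picard p f z - picard p g z\<bar> \<le> C * D \<tau> * \<eta>"
    using \<eta> by (simp add: picard_def z_eq integral_diff[OF int] mult_ac)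
  also have "\<dots> \<le> C * D \<tau> * 1" using \<eta> C0 D0 by (intro mult_left_mono) auto
  also have "\<dots> = (C * L' / lam) * (m * exp (lam * \<tau>))" by (simp add: D_def)
  also have "\<dots> \<le> 1 / 2 * (m * exp (lam * \<tau>))"
    using lam lam0 m0 by (intro mult_right_mono) (auto simp: field_simps)
  finally show ?thesis by (simp add: z_eq)
qed

text \<open>
  The operator \<open>picard\<close> maps continuous functions to \<open>C\<^sup>1\<close> functions, so its fixed point is
  automatically regular. Its time derivative is computed from the primitive \<open>H\<close> of the slope in \<open>x\<close>: the moving
  endpoints contribute boundary values of \<open>P\<close>, and the integral that remains has the integrand
  \<open>K'(Q) P = \<partial>\<^sub>\<eta> K(Q)\<close>.
\<close>

lemma relaxed_solution_exists_unit:
  assumes p: "continuous_on {0..1} p" "p 1 - p 0 = K \<Phi> - K 0"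
  obtains Q P where "relaxed_solution 1 Q P" "\<And>\<eta>. \<eta> \<in> {0..1} \<Longrightarrow> P 0 \<eta> = p \<eta>"
proof -
  have "bounded (p ` {0..1})"
    by (intro compact_imp_bounded compact_continuous_image p(1) compact_Icc)
  then obtain B where B: "\<And>x. x \<in> {0..1} \<Longrightarrow> \<bar>p x\<bar> \<le> B"
    unfolding bounded_iff real_norm_def by blast
  define C where "C = B * exp L * exp (2 * L) + (B * exp L + \<bar>K \<Phi> - K 0\<bar>) * exp (2 * L) * 2"
  \<comment> \<open>a nonnegative exponent makes the weight at least \<open>1\<close>\<close>
  define lam where "lam = max 0 (2 * (C * L') + 1)"
  obtain f where f: "continuous_on ({0..1} \<times> {0..1}) f"
    and fixpoint: "\<And>z. z \<in> {0..1} \<times> {0..1} \<Longrightarrow> picard p f z = f z"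
  proof (rule weighted_contraction_fixed_point[of "{0..1} \<times> {0..1}" "\<lambda>z. exp (lam * fst z)" "picard p"])
    show "compact ({0..1::real} \<times> {0..1::real})" by (intro compact_Times compact_Icc)
    show "\<bar>picard p f z - picard p g z\<bar> \<le> m / 2 * exp (lam * fst z)"
      if "continuous_on ({0..1} \<times> {0..1}) f" "continuous_on ({0..1} \<times> {0..1}) g"
        "\<And>z. z \<in> {0..1} \<times> {0..1} \<Longrightarrow> \<bar>f z - g z\<bar> \<le> m * exp (lam * fst z)" "z \<in> {0..1} \<times> {0..1}" for f g m z
      by (rule picard_contraction[OF that(1,2) p B C_def _ that(3,4)]) (auto simp: lam_def)
  qed (auto intro!: continuous_intros continuous_on_picard p simp: lam_def)
  define P where "P \<tau> \<eta> = slope p f \<tau> (\<eta> - \<tau>)" for \<tau> \<eta>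
  define Q where "Q \<tau> \<eta> = integral {0..\<eta>} (P \<tau>)" for \<tau> \<eta>
  have Q_f: "Q \<tau> \<eta> = f (\<tau>, \<eta>)" if "\<tau> \<in> {0..1}" "\<eta> \<in> {0..1}" for \<tau> \<eta>
    using fixpoint[of "(\<tau>, \<eta>)"] that by (simp add: Q_def picard_def P_def[abs_def])
  have P_cont: "continuous_on ({0..1} \<times> {0..1}) (\<lambda>(\<tau>, \<eta>). P \<tau> \<eta>)"
    unfolding P_def case_prod_unfold by (intro continuous_on_slope[OF f p] continuous_intros) auto
  have P_cont': "continuous_on {0..1} (P \<tau>)" if "\<tau> \<in> {0..1}" for \<tau>
    unfolding P_def[abs_def] using that by (intro continuous_on_slope[OF f p] continuous_intros) auto
  have Q_eta: "(Q \<tau> has_real_derivative P \<tau> \<eta>) (at \<eta> within {0..1})" if "\<tau> \<in> {0..1}" "\<eta> \<in> {0..1}" for \<tau> \<eta>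
    unfolding Q_def[abs_def] by (rule integral_has_real_derivative[OF P_cont'[OF that(1)] that(2)])
  define H where "H \<tau> a = integral {-1..a} (slope p f \<tau>)" for \<tau> a
  have slope_cont: "continuous_on {-1..1} (slope p f \<tau>)" if "\<tau> \<in> {0..1}" for \<tau>
    using that by (intro continuous_on_slope[OF f p] continuous_intros) auto
  have H_a: "(H \<tau> has_real_derivative slope p f \<tau> a) (at a within {-1..1})" if "\<tau> \<in> {0..1}" "a \<in> {-1..1}" for \<tau> a
    unfolding H_def[abs_def] by (rule integral_has_real_derivative[OF slope_cont[OF that(1)] that(2)])
  define h where "h \<tau> x = slope p f \<tau> x * rate f \<tau> (x + \<tau>)" for \<tau> x
  have H_tau: "((\<lambda>\<tau>. H \<tau> a) has_real_derivative integral {-1..a} (h \<tau>)) (at \<tau> within {0..1})"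
    if "\<tau> \<in> {0..1}" "a \<in> {-1..1}" for \<tau> a
  proof -
    have "((\<lambda>\<tau>. integral (cbox (-1) a) (slope p f \<tau>)) has_real_derivative integral (cbox (-1) a) (h \<tau>))
        (at \<tau> within {0..1})"
    proof (rule leibniz_rule_field_derivative)
      show "((\<lambda>\<tau>. slope p f \<tau> x) has_real_derivative h \<tau> x) (at \<tau> within {0..1})" if "\<tau> \<in> {0..1}" for \<tau> x
        unfolding h_def by (rule slope_deriv[OF f p that])
      show "slope p f \<tau> integrable_on cbox (-1) a" if "\<tau> \<in> {0..1}" for \<tau>
        unfolding box_real
        by (rule integrable_continuous_real, rule continuous_on_subset[OF slope_cont[OF that]])
           (use \<open>a \<in> {-1..1}\<close> in auto)
      show "continuous_on ({0..1} \<times> cbox (-1) a) (\<lambda>(\<tau>, x). h \<tau> x)"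
        unfolding h_def case_prod_unfold using that
        by (intro continuous_intros continuous_on_slope[OF f p] continuous_on_rate[OF f]) auto
    qed (use that in auto)
    then show ?thesis by (simp add: H_def)
  qed
  have slope_cont2: "continuous_on ({0..1} \<times> {-1..1}) (\<lambda>(\<tau>, a). slope p f \<tau> a)"
    unfolding case_prod_unfold by (intro continuous_on_slope[OF f p] continuous_intros) auto
  have H_path: "((\<lambda>s. H s (\<eta> - s)) has_real_derivative integral {-1..\<eta> - \<tau>} (h \<tau>) - slope p f \<tau> (\<eta> - \<tau>)) (at \<tau> within {0..1})"
    if "\<tau> \<in> {0..1}" "\<eta> \<in> {0..1}" for \<tau> \<eta>
  proof -
    have "((\<lambda>s. H s (\<eta> - s)) has_real_derivative integral {-1..\<eta> - \<tau>} (h \<tau>) * 1 + slope p f \<tau> (\<eta> - \<tau>) * (-1)) (at \<tau> within {0..1})"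
      by (rule has_real_derivative_along_path[where X="{0..1}" and Y="{-1..1}" and ?f2.0="slope p f"])
         (use that H_tau H_a slope_cont2 in \<open>auto intro!: derivative_eq_intros\<close>)
    then show ?thesis by simp
  qed
  have Q_H: "Q s \<eta> = H s (\<eta> - s) - H s (0 - s)" if "s \<in> {0..1}" "\<eta> \<in> {0..1}" for s \<eta>
  proof -
    have "((\<lambda>\<xi>. P s \<xi>) has_integral H s (\<eta> - s) - H s (0 - s)) {0..\<eta>}"
    proof (rule fundamental_theorem_of_calculus)
      show "((\<lambda>\<xi>. H s (\<xi> - s)) has_vector_derivative P s \<xi>) (at \<xi> within {0..\<eta>})" if "\<xi> \<in> {0..\<eta>}" for \<xi>
      proof -
        have "((\<lambda>\<xi>. H s (\<xi> - s)) has_real_derivative slope p f s (\<xi> - s) * 1) (at \<xi> within {0..\<eta>})"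
        proof (rule DERIV_image_chain[where g="\<lambda>\<xi>. \<xi> - s" and f="H s", unfolded o_def])
          show "(H s has_real_derivative slope p f s (\<xi> - s)) (at (\<xi> - s) within (\<lambda>\<xi>. \<xi> - s) ` {0..\<eta>})"
            by (rule has_field_derivative_subset[OF H_a]) (use that \<open>s \<in> {0..1}\<close> \<open>\<eta> \<in> {0..1}\<close> in auto)
        qed (auto intro!: derivative_eq_intros)
        then show ?thesis by (simp add: P_def has_real_derivative_iff_has_vector_derivative)
      qed
    qed (use that in auto)
    then show ?thesis by (simp add: Q_def integral_unique)
  qed
  have Q_0: "Q \<tau> 0 = 0" for \<tau> by (simp add: Q_def)
  have h_int: "integral {-1..\<eta> - \<tau>} (h \<tau>) - integral {-1..0 - \<tau>} (h \<tau>) = K (Q \<tau> \<eta>) - K 0"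
    if \<tau>: "\<tau> \<in> {0..1}" and \<eta>: "\<eta> \<in> {0..1}" for \<tau> \<eta>
  proof -
    have h_cont: "continuous_on {-1..1} (h \<tau>)"
      unfolding h_def[abs_def] using \<tau>
      by (intro continuous_intros slope_cont continuous_on_rate[OF f]) auto
    have "integral {-1..0 - \<tau>} (h \<tau>) + integral {0 - \<tau>..\<eta> - \<tau>} (h \<tau>) = integral {-1..\<eta> - \<tau>} (h \<tau>)"
      by (rule Henstock_Kurzweil_Integration.integral_combine)
         (use \<tau> \<eta> in \<open>auto intro!: integrable_continuous_real continuous_on_subset[OF h_cont]\<close>)
    moreover have "(h \<tau> has_integral K (Q \<tau> ((\<eta> - \<tau>) + \<tau>)) - K (Q \<tau> ((0 - \<tau>) + \<tau>))) {0 - \<tau>..\<eta> - \<tau>}"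
    proof (rule fundamental_theorem_of_calculus)
      show "((\<lambda>x. K (Q \<tau> (x + \<tau>))) has_vector_derivative h \<tau> x) (at x within {0 - \<tau>..\<eta> - \<tau>})"
        if x: "x \<in> {0 - \<tau>..\<eta> - \<tau>}" for x
      proof -
        have "((\<lambda>x. Q \<tau> (x + \<tau>)) has_real_derivative P \<tau> (x + \<tau>) * 1) (at x within {0 - \<tau>..\<eta> - \<tau>})"
        proof (rule DERIV_image_chain[where g="\<lambda>x. x + \<tau>" and f="Q \<tau>", unfolded o_def])
          show "(Q \<tau> has_real_derivative P \<tau> (x + \<tau>)) (at (x + \<tau>) within (\<lambda>x. x + \<tau>) ` {0 - \<tau>..\<eta> - \<tau>})"
            by (rule has_field_derivative_subset[OF Q_eta]) (use x \<tau> \<eta> in auto)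
        qed (auto intro!: derivative_eq_intros)
        from DERIV_chain2[OF K_deriv this] have "((\<lambda>x. K (Q \<tau> (x + \<tau>))) has_real_derivative
            k (Q \<tau> (x + \<tau>)) * (P \<tau> (x + \<tau>) * 1)) (at x within {0 - \<tau>..\<eta> - \<tau>})" .
        moreover have "k (Q \<tau> (x + \<tau>)) * (P \<tau> (x + \<tau>) * 1) = h \<tau> x"
        proof -
          have "max 0 (min 1 \<tau>) = \<tau>" "max 0 (min 1 (x + \<tau>)) = x + \<tau>" using x \<tau> \<eta> by auto
          then show ?thesis using x \<tau> \<eta> Q_f[of \<tau> "x + \<tau>"] by (simp add: h_def P_def rate_def)
        qed
        ultimately show ?thesis by (simp add: has_real_derivative_iff_has_vector_derivative)
      qed
    qed (use \<eta> in auto)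
    ultimately show ?thesis by (simp add: integral_unique Q_0)
  qed
  have "relaxed_solution 1 Q P"
    unfolding relaxed_solution_def
  proof (intro conjI ballI P_cont Q_0 Q_eta)
    fix \<tau> \<eta> :: real assume \<tau>: "\<tau> \<in> {0..1}" and \<eta>: "\<eta> \<in> {0..1}"
    show "((\<lambda>s. Q s \<eta>) has_real_derivative P \<tau> 1 - K \<Phi> + K (Q \<tau> \<eta>) - P \<tau> \<eta>) (at \<tau> within {0..1})"
    proof (rule has_field_derivative_transform_within[OF _ zero_less_one \<tau>])
      have "((\<lambda>s. H s (\<eta> - s) - H s (0 - s)) has_real_derivative
          (integral {-1..\<eta> - \<tau>} (h \<tau>) - slope p f \<tau> (\<eta> - \<tau>)) - (integral {-1..0 - \<tau>} (h \<tau>) - slope p f \<tau> (0 - \<tau>)))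
          (at \<tau> within {0..1})"
        by (intro DERIV_diff H_path \<tau> \<eta>) simp
      moreover have "(integral {-1..\<eta> - \<tau>} (h \<tau>) - slope p f \<tau> (\<eta> - \<tau>)) - (integral {-1..0 - \<tau>} (h \<tau>) - slope p f \<tau> (0 - \<tau>))
          = P \<tau> 1 - K \<Phi> + K (Q \<tau> \<eta>) - P \<tau> \<eta>"
        using h_int[OF \<tau> \<eta>] slope_reentry[OF f p \<tau>] by (simp add: P_def)
      ultimately show "((\<lambda>s. H s (\<eta> - s) - H s (0 - s)) has_real_derivative
          P \<tau> 1 - K \<Phi> + K (Q \<tau> \<eta>) - P \<tau> \<eta>) (at \<tau> within {0..1})" by simp
    qed (use Q_H \<eta> in simp)
  qed auto
  moreover have "P 0 \<eta> = p \<eta>" if "\<eta> \<in> {0..1}" for \<eta>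
    using that by (simp add: P_def slope_def launch_def growth_0[OF f])
  ultimately show thesis by (rule that)
qed

section \<open>Global existence\<close>

text \<open>
  At the joint the two one-sided time derivatives of \<open>Q\<close> agree because both are given by the equation, whose
  right-hand side involves only \<open>Q\<close> and \<open>P\<close>.
\<close>

lemma relaxed_solution_glue:
  assumes sol1: "relaxed_solution a Q1 P1" and sol2: "relaxed_solution b Q2 P2"
    and "a > 0" "b > 0" and P_eq: "\<And>\<eta>. \<eta> \<in> {0..1} \<Longrightarrow> P2 0 \<eta> = P1 a \<eta>"
  shows "relaxed_solution (a + b) (\<lambda>\<tau>. if \<tau> \<le> a then Q1 \<tau> else Q2 (\<tau> - a))
           (\<lambda>\<tau>. if \<tau> \<le> a then P1 \<tau> else P2 (\<tau> - a))" (is "relaxed_solution _ ?Q ?P")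
proof -
  have Q_eq: "Q2 0 \<eta> = Q1 a \<eta>" if "\<eta> \<in> {0..1}" for \<eta>
  proof -
    have "integral {0..\<eta>} (P2 0) = integral {0..\<eta>} (P1 a)"
      by (rule integral_cong) (use that P_eq in auto)
    then show ?thesis using Q_eq_integral[OF sol1, of a \<eta>] Q_eq_integral[OF sol2, of 0 \<eta>] that assms(3,4) by simp
  qed
  have Q_ge: "?Q s \<eta> = Q2 (s - a) \<eta>" and P_ge: "?P s \<eta> = P2 (s - a) \<eta>" if "s \<ge> a" "\<eta> \<in> {0..1}" for s \<eta>
    using that Q_eq P_eq by (cases "s = a"; simp)+
  have cont: "continuous_on ({0..a + b} \<times> {0..1}) (\<lambda>z. ?P (fst z) (snd z))"
  proof -
    have 1: "continuous_on ({0..a} \<times> {0..1}) (\<lambda>z. ?P (fst z) (snd z))"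
    proof (rule continuous_on_eq)
      show "continuous_on ({0..a} \<times> {0..1}) (\<lambda>z. P1 (fst z) (snd z))"
        by (intro continuous_on_P[OF sol1] continuous_intros) auto
    qed auto
    have 2: "continuous_on ({a..a + b} \<times> {0..1}) (\<lambda>z. ?P (fst z) (snd z))"
    proof (rule continuous_on_eq)
      show "continuous_on ({a..a + b} \<times> {0..1}) (\<lambda>z. P2 (fst z - a) (snd z))"
        by (intro continuous_on_P[OF sol2] continuous_intros) auto
      show "P2 (fst z - a) (snd z) = ?P (fst z) (snd z)" if "z \<in> {a..a + b} \<times> {0..1}" for z
        by (rule P_ge[symmetric]) (use that in auto)
    qed
    have "{0..a + b} \<times> {0..1::real} = ({0..a} \<times> {0..1}) \<union> ({a..a + b} \<times> {0..1})"
      using assms(3,4) by auto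
    then show ?thesis
      using continuous_on_closed_Un[OF _ _ 1 2] by (simp add: closed_Times)
  qed
  show ?thesis
    unfolding relaxed_solution_def
  proof (intro conjI ballI)
    show "continuous_on ({0..a + b} \<times> {0..1}) (\<lambda>(\<tau>, \<eta>). ?P \<tau> \<eta>)"
      using cont by (simp only: case_prod_unfold)
    fix \<tau> assume \<tau>: "\<tau> \<in> {0..a + b}"
    show "?Q \<tau> 0 = 0" using Q_zero[OF sol1] Q_zero[OF sol2] \<tau> by auto
    fix \<eta> :: real assume \<eta>: "\<eta> \<in> {0..1}"
    show "(?Q \<tau> has_real_derivative ?P \<tau> \<eta>) (at \<eta> within {0..1})"
      using Q_eta[OF sol1, of \<tau> \<eta>] Q_eta[OF sol2, of "\<tau> - a" \<eta>] \<tau> \<eta> by auto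
    define D where "D = ?P \<tau> 1 - K \<Phi> + K (?Q \<tau> \<eta>) - ?P \<tau> \<eta>"
    have left: "((\<lambda>s. ?Q s \<eta>) has_real_derivative D) (at \<tau> within {0..a})" if "\<tau> \<le> a"
    proof (rule has_field_derivative_transform_within[OF _ zero_less_one])
      show "((\<lambda>s. Q1 s \<eta>) has_real_derivative D) (at \<tau> within {0..a})"
        using Q_tau[OF sol1, of \<tau> \<eta>] \<tau> \<eta> that by (simp add: D_def)
    qed (use that \<tau> in auto)
    have right: "((\<lambda>s. ?Q s \<eta>) has_real_derivative D) (at \<tau> within {a..a + b})" if "\<tau> \<ge> a"
    proof (rule has_field_derivative_transform_within[OF _ zero_less_one])
      have "((\<lambda>s. Q2 (s - a) \<eta>) has_real_derivative
          (P2 (\<tau> - a) 1 - K \<Phi> + K (Q2 (\<tau> - a) \<eta>) - P2 (\<tau> - a) \<eta>) * 1) (at \<tau> within {a..a + b})"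
      proof (rule DERIV_image_chain[where g="\<lambda>s. s - a" and f="\<lambda>s. Q2 s \<eta>", unfolded o_def])
        show "((\<lambda>s. Q2 s \<eta>) has_real_derivative P2 (\<tau> - a) 1 - K \<Phi> + K (Q2 (\<tau> - a) \<eta>) - P2 (\<tau> - a) \<eta>)
            (at (\<tau> - a) within (\<lambda>s. s - a) ` {a..a + b})"
          by (rule has_field_derivative_subset[OF Q_tau[OF sol2]]) (use that \<tau> \<eta> in auto)
      qed (auto intro!: derivative_eq_intros)
      then show "((\<lambda>s. Q2 (s - a) \<eta>) has_real_derivative D) (at \<tau> within {a..a + b})"
        unfolding D_def using P_ge[OF that, of 1] P_ge[OF that \<eta>] Q_ge[OF that \<eta>] by simp
      show "Q2 (s - a) \<eta> = ?Q s \<eta>" if "s \<in> {a..a + b}" for s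
        by (rule Q_ge[symmetric]) (use that \<eta> in auto)
    qed (use that \<tau> in auto)
    have "((\<lambda>s. ?Q s \<eta>) has_real_derivative D) (at \<tau> within {0..a + b})"
    proof (cases \<tau> a rule: linorder_cases)
      case less
      have "at \<tau> within {0..a + b} = at \<tau> within {0..a}"
        by (rule at_within_nhd[where S="{..<a}"]) (use less \<open>b > 0\<close> in auto)
      then show ?thesis using left less by simp
    next
      case equal
      have "{0..a + b} = {0..a} \<union> {a..a + b}" using assms(3,4) by auto
      then show ?thesis using has_real_derivative_within_Un[OF left right] equal by simp
    next
      case greater
      have "at \<tau> within {0..a + b} = at \<tau> within {a..a + b}"
        by (rule at_within_nhd[where S="{a<..}"]) (use greater \<open>a > 0\<close> in auto)
      then show ?thesis using right greater by simp
    qed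
    then show "((\<lambda>s. ?Q s \<eta>) has_real_derivative ?P \<tau> 1 - K \<Phi> + K (?Q \<tau> \<eta>) - ?P \<tau> \<eta>) (at \<tau> within {0..a + b})"
      by (simp only: D_def)
  qed
qed

text \<open>
  By re-entry the profile of \<open>P\<close> at the end of a unit interval satisfies the compatibility condition again, so
  it can serve as the next datum.
\<close>

theorem relaxed_solution_exists:
  assumes p: "continuous_on {0..1} p" "p 1 - p 0 = K \<Phi> - K 0"
  obtains Q P where "relaxed_solution T Q P" "\<And>\<eta>. \<eta> \<in> {0..1} \<Longrightarrow> P 0 \<eta> = p \<eta>"
proof -
  have "\<exists>Q P. relaxed_solution (real (Suc n)) Q P \<and> (\<forall>\<eta>\<in>{0..1}. P 0 \<eta> = p \<eta>)" for n
  proof (induction n)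
    case 0
    show ?case using relaxed_solution_exists_unit[OF p] by (metis of_nat_1 One_nat_def)
  next
    case (Suc n)
    define a where "a = real (Suc n)"
    have a: "a > 0" by (simp add: a_def)
    obtain Q1 P1 where sol1: "relaxed_solution a Q1 P1" and P1: "\<And>\<eta>. \<eta> \<in> {0..1} \<Longrightarrow> P1 0 \<eta> = p \<eta>"
      using Suc unfolding a_def by blast
    have "continuous_on {0..1} (P1 a)"
      by (intro continuous_on_P[OF sol1] continuous_intros) (use a in auto)
    moreover have "P1 a 1 - P1 a 0 = K \<Phi> - K 0"
      using reentry[OF sol1, of a] a by simp
    ultimately obtain Q2 P2 where sol2: "relaxed_solution 1 Q2 P2" and P2: "\<And>\<eta>. \<eta> \<in> {0..1} \<Longrightarrow> P2 0 \<eta> = P1 a \<eta>"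
      using relaxed_solution_exists_unit by blast
    have "a + 1 = real (Suc (Suc n))" by (simp add: a_def)
    with relaxed_solution_glue[OF sol1 sol2 a zero_less_one P2] P1 a show ?case
      by (intro exI conjI) auto
  qed
  moreover obtain n where "T \<le> real (Suc n)"
    using real_arch_simple[of T] by (metis Suc_n_not_le_n nat_le_linear of_nat_le_iff order_trans)
  ultimately show thesis using relaxed_solution_restrict that by blast
qed

section \<open>Relaxed and classical solutions\<close>

text \<open>
  The equations of a classical solution hold for positive times and interior \<open>\<eta>\<close>; continuity of both sides
  carries them over to the boundary of \<open>[0,T] \<times> [0,1]\<close>.
\<close>

lemma relaxed_solution_of_classical:
  assumes cl: "classical_solution K \<Phi> Tmax q Q N" and T: "0 < T" "ereal T < Tmax" and "q 0 = 0"
  shows "relaxed_solution T Q (d_eta Q)"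
    and "\<And>\<tau>. \<tau> \<in> {0..T} \<Longrightarrow> 1 / N \<tau> = d_eta Q \<tau> 1 - K \<Phi>"
    and "\<And>\<eta>. \<eta> \<in> {0..1} \<Longrightarrow> d_eta Q 0 \<eta> = deriv01 q \<eta>"
proof -
  have sub: "{0..T} \<subseteq> times Tmax" using T by (auto simp: times_def intro: le_less_trans[of _ "ereal T"])
  have C1: "C1_time_space Tmax Q" and N_cont: "continuous_on {0..T} N" and N_pos: "\<And>\<tau>. \<tau> \<in> {0..T} \<Longrightarrow> N \<tau> > 0"
    and sys: "solves_system K \<Phi> Tmax q Q N"
    using cl sub by (auto simp: classical_solution_def intro: continuous_on_subset)
  have rect: "{0..T} \<times> {0..1} \<subseteq> times Tmax \<times> {0..1}" using sub by auto
  have d_eta_cont: "continuous_on ({0..T} \<times> {0..1}) (\<lambda>(\<tau>, \<eta>). d_eta Q \<tau> \<eta>)"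
    and d_tau_cont: "continuous_on ({0..T} \<times> {0..1}) (\<lambda>(\<tau>, \<eta>). d_tau Tmax Q \<tau> \<eta>)"
    and Q_cont: "continuous_on ({0..T} \<times> {0..1}) (\<lambda>(\<tau>, \<eta>). Q \<tau> \<eta>)"
    using C1 rect by (auto simp: C1_time_space_def intro: continuous_on_subset)
  have Q_eta': "(Q \<tau> has_real_derivative d_eta Q \<tau> \<eta>) (at \<eta> within {0..1})" if "\<tau> \<in> {0..T}" "\<eta> \<in> {0..1}" for \<tau> \<eta>
  proof -
    have "Q \<tau> differentiable at \<eta> within {0..1}"
      using C1 sub that by (auto simp: C1_time_space_def differentiable_on_def)
    then show ?thesis
      by (simp add: has_real_derivative_iff_has_vector_derivative d_eta_def vector_derivative_works)
  qed
  have Q_tau': "((\<lambda>s. Q s \<eta>) has_real_derivative d_tau Tmax Q \<tau> \<eta>) (at \<tau> within {0..T})"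
    if "\<tau> \<in> {0..T}" "\<eta> \<in> {0..1}" for \<tau> \<eta>
  proof -
    have "(\<lambda>s. Q s \<eta>) differentiable at \<tau> within times Tmax"
      using C1 sub that by (auto simp: C1_time_space_def differentiable_on_def)
    then have "((\<lambda>s. Q s \<eta>) has_real_derivative d_tau Tmax Q \<tau> \<eta>) (at \<tau> within times Tmax)"
      by (simp add: has_real_derivative_iff_has_vector_derivative d_tau_def vector_derivative_works)
    then show ?thesis by (rule has_field_derivative_subset) (rule sub)
  qed
  have cl_time: "closure {0<..<T} = {0..T}" and cl_rect: "closure ({0<..<T} \<times> {0<..<1::real}) = {0..T} \<times> {0..1}"
    using T by (auto simp: closure_Times)
  have N_inv_cont: "continuous_on {0..T} (\<lambda>\<tau>. 1 / N \<tau>)"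
    by (intro continuous_intros N_cont) (use N_pos in force)
  have cont_eta: "continuous_on S (\<lambda>z. d_eta Q (a z) (b z))"
    if "continuous_on S a" "continuous_on S b" "a ` S \<subseteq> {0..T}" "b ` S \<subseteq> {0..1}" for S and a b :: "'z::topological_space \<Rightarrow> real"
  proof -
    have "continuous_on S (\<lambda>x. (a x, b x))" by (intro continuous_intros that)
    moreover have "(\<lambda>x. (a x, b x)) ` S \<subseteq> {0..T} \<times> {0..1}" using that(3,4) by fast
    ultimately show ?thesis using continuous_on_compose2[OF d_eta_cont, of S "\<lambda>x. (a x, b x)"] by simp
  qed
  show N_eq: "1 / N \<tau> = d_eta Q \<tau> 1 - K \<Phi>" if "\<tau> \<in> {0..T}" for \<tau>
  proof (rule continuous_constant_on_closure[where S="{0<..<T}" and f="\<lambda>\<tau>. 1 / N \<tau> - (d_eta Q \<tau> 1 - K \<Phi>)" and a=0, THEN eq_iff_diff_eq_0[THEN iffD2]])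
    show "continuous_on (closure {0<..<T}) (\<lambda>\<tau>. 1 / N \<tau> - (d_eta Q \<tau> 1 - K \<Phi>))"
      unfolding cl_time by (intro continuous_intros N_inv_cont cont_eta) auto
    show "1 / N s - (d_eta Q s 1 - K \<Phi>) = 0" if "s \<in> {0<..<T}" for s
      using sys sub that by (auto simp: solves_system_def subset_iff)
  qed (use that cl_time in simp)
  have pde: "d_tau Tmax Q \<tau> \<eta> = d_eta Q \<tau> 1 - K \<Phi> + K (Q \<tau> \<eta>) - d_eta Q \<tau> \<eta>"
    if "\<tau> \<in> {0..T}" "\<eta> \<in> {0..1}" for \<tau> \<eta>
  proof -
    define f where "f z = d_tau Tmax Q (fst z) (snd z) - (d_eta Q (fst z) 1 - K \<Phi> + K (Q (fst z) (snd z)) - d_eta Q (fst z) (snd z))" for z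
    have "f (\<tau>, \<eta>) = 0"
    proof (rule continuous_constant_on_closure[where S="{0<..<T} \<times> {0<..<1}" and f=f])
      show "continuous_on (closure ({0<..<T} \<times> {0<..<1})) f"
        unfolding cl_rect f_def using d_tau_cont Q_cont
        by (intro continuous_intros cont_eta) (auto simp: case_prod_unfold)
      show "f z = 0" if "z \<in> {0<..<T} \<times> {0<..<1}" for z
      proof -
        have z: "fst z \<in> times Tmax" "fst z > 0" "snd z \<in> {0<..<1}" using that sub by auto
        then have "d_tau Tmax Q (fst z) (snd z) + d_eta Q (fst z) (snd z) = 1 / N (fst z) + K (Q (fst z) (snd z))"
          "1 / N (fst z) = d_eta Q (fst z) 1 - K \<Phi>"
          using sys unfolding solves_system_def by blast+
        then show ?thesis by (simp add: f_def)
      qed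
    qed (use that cl_rect in simp)
    then show ?thesis by (simp add: f_def)
  qed
  have "Q \<tau> 0 = 0" if "\<tau> \<in> {0..T}" for \<tau>
  proof (cases "\<tau> = 0")
    case True
    then show ?thesis using sys assms(4) by (simp add: solves_system_def)
  next
    case False
    then show ?thesis using sys sub that by (auto simp: solves_system_def subset_iff)
  qed
  then show "relaxed_solution T Q (d_eta Q)"
    unfolding relaxed_solution_def using d_eta_cont Q_eta' Q_tau' pde by simp
  show "d_eta Q 0 \<eta> = deriv01 q \<eta>" if \<eta>: "\<eta> \<in> {0..1}" for \<eta>
  proof -
    have "(q has_real_derivative d_eta Q 0 \<eta>) (at \<eta> within {0..1})"
      by (rule has_field_derivative_transform_within[OF Q_eta' zero_less_one \<eta>])
         (use \<eta> T sys in \<open>auto simp: solves_system_def\<close>)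
    then have "deriv01 q \<eta> = d_eta Q 0 \<eta>"
      by (intro vector_derivative_within)
         (use \<eta> in \<open>auto simp: has_real_derivative_iff_has_vector_derivative trivial_limit_within\<close>)
    then show ?thesis ..
  qed
qed

text \<open>
  Beyond the sign of \<open>P(\<tau>, 1) - K(\<Phi>)\<close>, the point to check is monotonicity in \<open>\<eta>\<close>, which is the
  nonnegativity of \<open>P\<close>.
\<close>

lemma classical_of_relaxed_solution:
  assumes sol: "relaxed_solution T Q P" and T: "T > 0" and K_pos: "K \<Phi> \<ge> 0" "K 0 \<ge> 0"
    and init: "initial_datum K \<Phi> q" and P_init: "\<And>\<eta>. \<eta> \<in> {0..1} \<Longrightarrow> P 0 \<eta> = deriv01 q \<eta>"
    and bdry: "\<And>\<tau>. \<tau> \<in> {0..T} \<Longrightarrow> P \<tau> 1 > K \<Phi>"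
  shows "classical_solution K \<Phi> (ereal T) q Q (\<lambda>\<tau>. 1 / (P \<tau> 1 - K \<Phi>))"
proof -
  have times_eq: "times (ereal T) = {0..<T}" by (auto simp: times_def)
  have q: "C1_01 q" "mono_on {0..1} q" "q 0 = 0" using init by (auto simp: initial_datum_def)
  have q_deriv: "(q has_real_derivative deriv01 q \<eta>) (at \<eta> within {0..1})" if "\<eta> \<in> {0..1}" for \<eta>
    using q(1) that by (simp add: C1_01_def differentiable_on_def has_real_derivative_iff_has_vector_derivative vector_derivative_works)
  have P_nonneg': "P \<tau> \<eta> \<ge> 0" if "\<tau> \<in> {0..T}" "\<eta> \<in> {0..1}" for \<tau> \<eta>
  proof (rule P_nonneg[OF sol T K_pos _ _ that])
    show "P 0 x \<ge> 0" if "x \<in> {0..1}" for x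
    proof -
      have "((\<lambda>y. (q y - q x) / (y - x)) \<longlongrightarrow> deriv01 q x) (at x within {0..1})"
        using q_deriv[OF that] by (simp add: has_field_derivative_iff)
      moreover have "\<forall>\<^sub>F y in at x within {0..1}. 0 \<le> (q y - q x) / (y - x)"
        unfolding eventually_at_filter
      proof (intro always_eventually allI impI)
        fix y :: real assume "y \<noteq> x" "y \<in> {0..1}"
        then show "0 \<le> (q y - q x) / (y - x)"
          using mono_onD[OF q(2), of x y] mono_onD[OF q(2), of y x] that
          by (cases "x < y") (auto simp: zero_le_divide_iff)
      qed
      moreover have "at x within {0..1} \<noteq> bot" using that by (simp add: trivial_limit_within)
      ultimately have "0 \<le> deriv01 q x" by (metis tendsto_lowerbound)
      then show ?thesis using P_init that by simp
    qed
  qed (use bdry in \<open>auto intro: less_imp_le\<close>)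
  have eta: "d_eta Q \<tau> \<eta> = P \<tau> \<eta>" if "\<tau> \<in> {0..T}" "\<eta> \<in> {0..1}" for \<tau> \<eta>
    unfolding d_eta_def
    by (rule vector_derivative_within)
       (use that Q_eta[OF sol that] in \<open>auto simp: has_real_derivative_iff_has_vector_derivative trivial_limit_within\<close>)
  have sub: "{0..<T} \<subseteq> {0..T}" by auto
  have Q_tau': "((\<lambda>s. Q s \<eta>) has_real_derivative P \<tau> 1 - K \<Phi> + K (Q \<tau> \<eta>) - P \<tau> \<eta>) (at \<tau> within {0..<T})"
    if "\<tau> \<in> {0..<T}" "\<eta> \<in> {0..1}" for \<tau> \<eta>
    by (rule has_field_derivative_subset[OF Q_tau[OF sol] sub]) (use that in auto)
  have tau: "d_tau (ereal T) Q \<tau> \<eta> = P \<tau> 1 - K \<Phi> + K (Q \<tau> \<eta>) - P \<tau> \<eta>" if "\<tau> \<in> {0..<T}" "\<eta> \<in> {0..1}" for \<tau> \<eta>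
    unfolding d_tau_def times_eq
  proof (rule vector_derivative_within)
    have "\<tau> islimpt {0..<T}"
      using that T by (simp add: islimpt_Ico)
    then show "at \<tau> within {0..<T} \<noteq> bot" by (simp add: trivial_limit_within)
  qed (use Q_tau'[OF that] in \<open>simp add: has_real_derivative_iff_has_vector_derivative\<close>)
  have C1: "C1_time_space (ereal T) Q"
    unfolding C1_time_space_def times_eq
  proof (intro conjI ballI)
    show "(\<lambda>\<tau>. Q \<tau> \<eta>) differentiable_on {0..<T}" if "\<eta> \<in> {0..1}" for \<eta>
      using Q_tau' that by (force simp: differentiable_on_def intro: differentiableI_vector simp: has_real_derivative_iff_has_vector_derivative)
    show "Q \<tau> differentiable_on {0..1}" if "\<tau> \<in> {0..<T}" for \<tau>
      using Q_eta[OF sol, of \<tau>] that by (force simp: differentiable_on_def intro: differentiableI_vector simp: has_real_derivative_iff_has_vector_derivative)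
    show "continuous_on ({0..<T} \<times> {0..1}) (\<lambda>(\<tau>, \<eta>). Q \<tau> \<eta>)"
      unfolding case_prod_unfold by (intro continuous_on_Q[OF sol] continuous_intros) auto
    show "continuous_on ({0..<T} \<times> {0..1}) (\<lambda>(\<tau>, \<eta>). d_tau (ereal T) Q \<tau> \<eta>)"
    proof (rule continuous_on_eq)
      show "continuous_on ({0..<T} \<times> {0..1}) (\<lambda>z. P (fst z) 1 - K \<Phi> + K (Q (fst z) (snd z)) - P (fst z) (snd z))"
        by (intro continuous_intros continuous_on_Q[OF sol] continuous_on_P[OF sol]) auto
    qed (auto simp: tau)
    show "continuous_on ({0..<T} \<times> {0..1}) (\<lambda>(\<tau>, \<eta>). d_eta Q \<tau> \<eta>)"
    proof (rule continuous_on_eq)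
      show "continuous_on ({0..<T} \<times> {0..1}) (\<lambda>z. P (fst z) (snd z))"
        by (intro continuous_intros continuous_on_P[OF sol]) auto
    qed (auto simp: eta)
  qed
  have mono: "mono_on {0..1} (Q \<tau>)" if "\<tau> \<in> {0..T}" for \<tau>
  proof (rule mono_onI)
    fix x y :: real assume xy: "x \<in> {0..1}" "y \<in> {0..1}" "x \<le> y"
    have "(P \<tau> has_integral Q \<tau> y - Q \<tau> x) {x..y}"
    proof (rule fundamental_theorem_of_calculus[OF xy(3)])
      show "(Q \<tau> has_vector_derivative P \<tau> z) (at z within {x..y})" if "z \<in> {x..y}" for z
        using has_field_derivative_subset[OF Q_eta[OF sol \<open>\<tau> \<in> {0..T}\<close>, of z], of "{x..y}"] xy that
        by (simp add: has_real_derivative_iff_has_vector_derivative)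
    qed
    then have "0 \<le> Q \<tau> y - Q \<tau> x"
      by (rule has_integral_nonneg) (use xy P_nonneg'[OF that] in auto)
    then show "Q \<tau> x \<le> Q \<tau> y" by simp
  qed
  have Q_init: "Q 0 \<eta> = q \<eta>" if "\<eta> \<in> {0..1}" for \<eta>
  proof -
    have "(deriv01 q has_integral q \<eta> - q 0) {0..\<eta>}"
      by (rule fundamental_theorem_of_calculus)
         (use that has_field_derivative_subset[OF q_deriv] in \<open>auto simp: has_real_derivative_iff_has_vector_derivative[symmetric]\<close>)
    moreover have "Q 0 \<eta> = integral {0..\<eta>} (deriv01 q)"
      unfolding Q_eq_integral[OF sol, of 0 \<eta>] using Q_eq_integral[OF sol, of 0 \<eta>] that T
      by (simp, intro integral_cong) (use P_init in auto)
    ultimately show ?thesis using q(3) by (simp add: integral_unique)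
  qed
  show ?thesis
    unfolding classical_solution_def
  proof (intro conjI ballI)
    show "continuous_on (times (ereal T)) (\<lambda>\<tau>. 1 / (P \<tau> 1 - K \<Phi>))"
      unfolding times_eq
      by (intro continuous_intros continuous_on_P[OF sol]) (use bdry in force)+
    show "solves_system K \<Phi> (ereal T) q Q (\<lambda>\<tau>. 1 / (P \<tau> 1 - K \<Phi>))"
      unfolding solves_system_def times_eq using Q_init Q_zero[OF sol] by (auto simp: eta tau)
  qed (use T C1 mono bdry in \<open>auto simp: times_eq eta\<close>)
qed

text \<open>
  Lower semicontinuity of the maximal time in quantitative form: the global relaxed solution with datum \<open>q\<close> stays so close
  to the reference solution that it cannot lose positivity of \<open>P(\<tau>, 1) - K(\<Phi>)\<close> before \<open>T\<close>.
\<close>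

lemma max_time_ge:
  assumes sol: "relaxed_solution T Q0 P0" and T: "T > 0" and K_pos: "K \<Phi> \<ge> 0" "K 0 \<ge> 0"
    and B: "\<And>\<tau> \<eta>. \<tau> \<in> {0..T} \<Longrightarrow> \<eta> \<in> {0..1} \<Longrightarrow> \<bar>P0 \<tau> \<eta>\<bar> \<le> B"
    and lam: "lam > L + L' * B"
    and init: "initial_datum K \<Phi> q" and compat: "deriv01 q 1 - deriv01 q 0 = K \<Phi> - K 0"
    and close: "\<And>\<eta>. \<eta> \<in> {0..1} \<Longrightarrow> \<bar>deriv01 q \<eta> - P0 0 \<eta>\<bar> \<le> m"
    and margin: "\<And>\<tau>. \<tau> \<in> {0..T} \<Longrightarrow> P0 \<tau> 1 - K \<Phi> > m * exp (lam * \<tau>)"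
  shows "ereal T \<le> max_time K \<Phi> q"
proof -
  have "continuous_on {0..1} (deriv01 q)" using init by (simp add: initial_datum_def C1_01_def)
  from relaxed_solution_exists[OF this compat] obtain Q P
    where sol': "relaxed_solution T Q P" and P: "\<And>\<eta>. \<eta> \<in> {0..1} \<Longrightarrow> P 0 \<eta> = deriv01 q \<eta>"
    by metis
  have "P \<tau> 1 > K \<Phi>" if "\<tau> \<in> {0..T}" for \<tau>
    using relaxed_solution_stability[OF sol' sol T B lam, of m \<tau> 1] close P margin[OF that] that
    by (simp add: abs_le_iff)
  from classical_of_relaxed_solution[OF sol' T K_pos init P this]
  show ?thesis unfolding max_time_def by (intro Sup_upper) blast
qed

end

section \<open>Continuous dependence of the maximal time and of the solution\<close>

theorem theorem3p2:
  fixes K :: "real \<Rightarrow> real" and \<Phi>\<^sub>F :: real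
    and Qinit :: "real \<Rightarrow> real \<Rightarrow> real"
    and Q :: "real \<Rightarrow> real \<Rightarrow> real \<Rightarrow> real" and N :: "real \<Rightarrow> real \<Rightarrow> real"
  assumes "\<Phi>\<^sub>F > 0"
    and "K differentiable_on UNIV" and "deriv K C1_differentiable_on UNIV"
    and "bounded (range (deriv K))" and "bounded (range (deriv (deriv K)))"
    and "\<And>\<phi>. \<phi> \<in> {0..\<Phi>\<^sub>F} \<Longrightarrow> K \<phi> > 0"
    and "\<And>\<epsilon>. \<epsilon> \<ge> 0 \<Longrightarrow> initial_datum K \<Phi>\<^sub>F (Qinit \<epsilon>)"
    and "\<And>\<epsilon>. \<epsilon> \<ge> 0 \<Longrightarrow> deriv01 (Qinit \<epsilon>) 1 - deriv01 (Qinit \<epsilon>) 0 = K \<Phi>\<^sub>F - K 0"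
    and "converges_C1_01 Qinit (Qinit 0) (at_right 0)"
    and "\<And>\<epsilon>. \<epsilon> \<ge> 0 \<Longrightarrow>
           classical_solution K \<Phi>\<^sub>F (max_time K \<Phi>\<^sub>F (Qinit \<epsilon>)) (Qinit \<epsilon>) (Q \<epsilon>) (N \<epsilon>)"
  shows "Liminf (at_right 0) (\<lambda>\<epsilon>. max_time K \<Phi>\<^sub>F (Qinit \<epsilon>)) \<ge> max_time K \<Phi>\<^sub>F (Qinit 0) \<and>
    (\<forall>T>0. ereal T < max_time K \<Phi>\<^sub>F (Qinit 0) \<longrightarrow>
       uniform_limit {0..T} N (N 0) (at_right 0) \<and>
       converges_C1_01 (\<lambda>\<epsilon>. Q \<epsilon> T) (Q 0 T) (at_right 0))"
proof -
  define k where "k = deriv K"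
  obtain L where L: "\<And>x. \<bar>k x\<bar> \<le> L"
    using assms(4) by (auto simp: bounded_iff k_def)
  obtain L' where L': "\<And>x. \<bar>deriv k x\<bar> \<le> L'"
    using assms(5) by (auto simp: bounded_iff k_def)
  have k_deriv: "(k has_real_derivative deriv k x) (at x)" for x
    using assms(3) unfolding k_def[symmetric] C1_differentiable_on_def
    by (metis DERIV_deriv_iff_real_differentiable UNIV_I has_real_derivative_iff_has_vector_derivative real_differentiable_def)
  interpret bounded_drift K k L L' \<Phi>\<^sub>F
  proof
    show "(K has_real_derivative k x) (at x)" for x
      using assms(2) by (auto simp: differentiable_on_def k_def DERIV_deriv_iff_real_differentiable)
    show "\<bar>k x - k y\<bar> \<le> L' * \<bar>x - y\<bar>" for x y
      using field_differentiable_bound[of UNIV k "deriv k" L' x y] k_deriv L' by simp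
  qed (rule L)
  have K_pos: "K \<Phi>\<^sub>F \<ge> 0" "K 0 \<ge> 0"
    using assms(1,6) by (auto intro: less_imp_le)
  define tm where "tm \<epsilon> = max_time K \<Phi>\<^sub>F (Qinit \<epsilon>)" for \<epsilon>
  have cl: "classical_solution K \<Phi>\<^sub>F (tm \<epsilon>) (Qinit \<epsilon>) (Q \<epsilon>) (N \<epsilon>)" if "\<epsilon> \<ge> 0" for \<epsilon>
    using assms(10)[OF that] by (simp add: tm_def)
  have q0: "Qinit \<epsilon> 0 = 0" if "\<epsilon> \<ge> 0" for \<epsilon>
    using assms(7)[OF that] by (simp add: initial_datum_def)
  define P where "P \<epsilon> = d_eta (Q \<epsilon>)" for \<epsilon>
  have sol: "relaxed_solution T (Q \<epsilon>) (P \<epsilon>)"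
    and N_eq: "\<And>\<tau>. \<tau> \<in> {0..T} \<Longrightarrow> 1 / N \<epsilon> \<tau> = P \<epsilon> \<tau> 1 - K \<Phi>\<^sub>F"
    and P_init: "\<And>\<eta>. \<eta> \<in> {0..1} \<Longrightarrow> P \<epsilon> 0 \<eta> = deriv01 (Qinit \<epsilon>) \<eta>"
    if "\<epsilon> \<ge> 0" "0 < T" "ereal T < tm \<epsilon>" for T \<epsilon>
    using relaxed_solution_of_classical[OF cl that(2,3) q0] that(1) by (auto simp: P_def)
  have pos: "\<forall>\<^sub>F \<epsilon> in at_right 0. \<epsilon> > (0::real)" by (rule eventually_at_right_less)
  have init_close: "\<forall>\<^sub>F \<epsilon> in at_right 0. \<forall>\<eta>\<in>{0..1}. \<bar>deriv01 (Qinit \<epsilon>) \<eta> - deriv01 (Qinit 0) \<eta>\<bar> \<le> m"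
    if "m > 0" for m
  proof -
    have "\<forall>\<^sub>F \<epsilon> in at_right 0. \<forall>\<eta>\<in>{0..1}. dist (deriv01 (Qinit \<epsilon>) \<eta>) (deriv01 (Qinit 0) \<eta>) < m"
      using assms(9) that by (intro uniform_limitD) (auto simp: converges_C1_01_def)
    then show ?thesis by eventually_elim (auto simp: dist_real_def intro: less_imp_le)
  qed
  have bounds: "\<exists>B. \<forall>\<tau>\<in>{0..T}. \<forall>\<eta>\<in>{0..1}. \<bar>P 0 \<tau> \<eta>\<bar> \<le> B"
    and gap: "\<exists>\<mu>>0. \<forall>\<tau>\<in>{0..T}. \<mu> \<le> P 0 \<tau> 1 - K \<Phi>\<^sub>F"
    if T: "0 < T" "ereal T < tm 0" for T
  proof -
    have "compact ((\<lambda>(\<tau>, \<eta>). P 0 \<tau> \<eta>) ` ({0..T} \<times> {0..1}))"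
      by (intro compact_continuous_image P_cont[OF sol] compact_Times compact_Icc) (use T in auto)
    from compact_imp_bounded[OF this] show "\<exists>B. \<forall>\<tau>\<in>{0..T}. \<forall>\<eta>\<in>{0..1}. \<bar>P 0 \<tau> \<eta>\<bar> \<le> B"
      by (auto simp: bounded_iff)
    have "continuous_on {0..T} (\<lambda>\<tau>. P 0 \<tau> 1 - K \<Phi>\<^sub>F)"
      by (intro continuous_intros continuous_on_P[OF sol]) (use T in auto)
    from continuous_attains_inf[OF compact_Icc _ this] T
    obtain t where t: "t \<in> {0..T}" "\<And>\<tau>. \<tau> \<in> {0..T} \<Longrightarrow> P 0 t 1 - K \<Phi>\<^sub>F \<le> P 0 \<tau> 1 - K \<Phi>\<^sub>F"
      by auto
    have "t \<in> times (tm 0)" using t(1) T by (auto simp: times_def intro: le_less_trans[of _ "ereal T"])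
    then have "P 0 t 1 - K \<Phi>\<^sub>F > 0" using cl[of 0] by (auto simp: classical_solution_def P_def)
    with t(2) show "\<exists>\<mu>>0. \<forall>\<tau>\<in>{0..T}. \<mu> \<le> P 0 \<tau> 1 - K \<Phi>\<^sub>F" by blast
  qed
  have lifespan: "\<forall>\<^sub>F \<epsilon> in at_right 0. ereal T \<le> tm \<epsilon>" if T: "0 < T" "ereal T < tm 0" for T
  proof -
    obtain B where B: "\<And>\<tau> \<eta>. \<tau> \<in> {0..T} \<Longrightarrow> \<eta> \<in> {0..1} \<Longrightarrow> \<bar>P 0 \<tau> \<eta>\<bar> \<le> B"
      using bounds[OF T] by blast
    obtain \<mu> where \<mu>: "\<mu> > 0" "\<And>\<tau>. \<tau> \<in> {0..T} \<Longrightarrow> \<mu> \<le> P 0 \<tau> 1 - K \<Phi>\<^sub>F"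
      using gap[OF T] by blast
    define lam where "lam = max 0 (L + L' * B) + 1"
    define m where "m = \<mu> / 2 / exp (lam * T)"
    have m: "m > 0" using \<mu> by (simp add: m_def)
    have margin: "m * exp (lam * \<tau>) < P 0 \<tau> 1 - K \<Phi>\<^sub>F" if "\<tau> \<in> {0..T}" for \<tau>
    proof -
      have "m * exp (lam * \<tau>) \<le> m * exp (lam * T)"
        using m that by (intro mult_left_mono) (auto simp: lam_def intro!: mult_left_mono)
      also have "\<dots> < \<mu>" using \<mu> by (simp add: m_def)
      finally show ?thesis using \<mu>(2)[OF that] by simp
    qed
    from init_close[OF m] pos show ?thesis
    proof eventually_elim
      case (elim \<epsilon>)
      show ?case
        unfolding tm_def
        by (rule max_time_ge[OF sol[OF _ T] T(1) K_pos B _ assms(7,8) _ margin])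
           (use elim P_init[OF _ T] in \<open>auto simp: lam_def\<close>)
    qed
  qed
  have P_close: "\<forall>\<^sub>F \<epsilon> in at_right 0. ereal T < tm \<epsilon> \<and> \<epsilon> > 0 \<and>
      (\<forall>\<tau>\<in>{0..T}. \<forall>\<eta>\<in>{0..1}. \<bar>P \<epsilon> \<tau> \<eta> - P 0 \<tau> \<eta>\<bar> \<le> e)"
    if T: "0 < T" "ereal T < tm 0" and e: "e > 0" for T e
  proof -
    \<comment> \<open>a lower bound \<open>T' \<le> tm \<epsilon>\<close> with \<open>T < T'\<close> makes \<open>T\<close> itself an admissible time\<close>
    obtain T' where T': "ereal T < ereal T'" "ereal T' < tm 0" using ereal_dense2[OF T(2)] by blast
    then have "0 < T'" using T by simp
    obtain B where B: "\<And>\<tau> \<eta>. \<tau> \<in> {0..T} \<Longrightarrow> \<eta> \<in> {0..1} \<Longrightarrow> \<bar>P 0 \<tau> \<eta>\<bar> \<le> B"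
      using bounds[OF T] by blast
    define lam where "lam = max 0 (L + L' * B) + 1"
    define m where "m = e / exp (lam * T)"
    have m: "m > 0" using e by (simp add: m_def)
    from lifespan[OF \<open>0 < T'\<close> T'(2)] init_close[OF m] pos show ?thesis
    proof eventually_elim
      case (elim \<epsilon>)
      then have T_less: "ereal T < tm \<epsilon>" using less_le_trans[OF T'(1)] by blast
      have "\<bar>P \<epsilon> \<tau> \<eta> - P 0 \<tau> \<eta>\<bar> \<le> e" if "\<tau> \<in> {0..T}" "\<eta> \<in> {0..1}" for \<tau> \<eta>
      proof -
        have "\<bar>P \<epsilon> \<tau> \<eta> - P 0 \<tau> \<eta>\<bar> \<le> m * exp (lam * \<tau>)"
          by (rule relaxed_solution_stability[OF sol[OF _ T(1) T_less] sol[OF _ T] T(1) B _ _ that])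
             (use elim P_init[OF _ T] P_init[OF _ T(1) T_less] in \<open>auto simp: lam_def\<close>)
        also have "\<dots> \<le> m * exp (lam * T)"
          using m that by (intro mult_left_mono) (auto simp: lam_def intro!: mult_left_mono)
        finally show ?thesis by (simp add: m_def)
      qed
      with T_less elim show ?case by blast
    qed
  qed
  have N_lim: "uniform_limit {0..T} N (N 0) (at_right 0)" if T: "0 < T" "ereal T < tm 0" for T
  proof -
    obtain \<mu> where \<mu>: "\<mu> > 0" "\<And>\<tau>. \<tau> \<in> {0..T} \<Longrightarrow> \<mu> \<le> P 0 \<tau> 1 - K \<Phi>\<^sub>F"
      using gap[OF T] by blast
    have "uniform_limit {0..T} (\<lambda>\<epsilon> \<tau>. P \<epsilon> \<tau> 1 - K \<Phi>\<^sub>F) (\<lambda>\<tau>. P 0 \<tau> 1 - K \<Phi>\<^sub>F) (at_right 0)"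
    proof (rule uniform_limitI)
      fix e :: real assume "e > 0"
      from P_close[OF T half_gt_zero[OF this]]
      show "\<forall>\<^sub>F \<epsilon> in at_right 0. \<forall>\<tau>\<in>{0..T}. dist (P \<epsilon> \<tau> 1 - K \<Phi>\<^sub>F) (P 0 \<tau> 1 - K \<Phi>\<^sub>F) < e"
      proof eventually_elim
        case (elim \<epsilon>)
        show ?case
        proof
          fix \<tau> assume "\<tau> \<in> {0..T}"
          then have "\<bar>P \<epsilon> \<tau> 1 - P 0 \<tau> 1\<bar> \<le> e / 2" using elim by simp
          then show "dist (P \<epsilon> \<tau> 1 - K \<Phi>\<^sub>F) (P 0 \<tau> 1 - K \<Phi>\<^sub>F) < e"
            using \<open>e > 0\<close> by (simp add: dist_real_def)
        qed
      qed
    qed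
    then have lim: "uniform_limit {0..T} (\<lambda>\<epsilon> \<tau>. inverse (P \<epsilon> \<tau> 1 - K \<Phi>\<^sub>F)) (inverse \<circ> (\<lambda>\<tau>. P 0 \<tau> 1 - K \<Phi>\<^sub>F)) (at_right 0)"
      by (rule uniform_lim_inverse[where b=\<mu>]) (use \<mu> in force)+
    have N_inv: "N \<epsilon> \<tau> = inverse (P \<epsilon> \<tau> 1 - K \<Phi>\<^sub>F)" if "\<epsilon> \<ge> 0" "ereal T < tm \<epsilon>" "\<tau> \<in> {0..T}" for \<epsilon> \<tau>
      using N_eq[OF that(1) T(1) that(2,3)] by (metis inverse_eq_divide inverse_inverse_eq)
    show ?thesis
    proof (rule iffD1[OF uniform_limit_cong lim])
      show "\<forall>\<^sub>F \<epsilon> in at_right 0. \<forall>\<tau>\<in>{0..T}. inverse (P \<epsilon> \<tau> 1 - K \<Phi>\<^sub>F) = N \<epsilon> \<tau>"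
        using P_close[OF T zero_less_one] by eventually_elim (use N_inv in auto)
    qed (use N_inv T in auto)
  qed
  have Q_lim: "converges_C1_01 (\<lambda>\<epsilon>. Q \<epsilon> T) (Q 0 T) (at_right 0)" if T: "0 < T" "ereal T < tm 0" for T
  proof -
    have Q_P_close: "\<forall>\<^sub>F \<epsilon> in at_right 0. \<forall>\<eta>\<in>{0..1}. \<bar>Q \<epsilon> T \<eta> - Q 0 T \<eta>\<bar> \<le> e \<and> \<bar>P \<epsilon> T \<eta> - P 0 T \<eta>\<bar> \<le> e"
      if "e > 0" for e
      using P_close[OF T that]
    proof eventually_elim
      case (elim \<epsilon>)
      have "\<bar>P \<epsilon> T \<eta> - P 0 T \<eta>\<bar> \<le> e" if "\<eta> \<in> {0..1}" for \<eta> using elim T that by simp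
      moreover from this have "\<bar>Q \<epsilon> T \<eta> - Q 0 T \<eta>\<bar> \<le> e" if "\<eta> \<in> {0..1}" for \<eta>
        by (intro Q_diff_le[OF sol sol _ _ that]) (use elim T in auto)
      ultimately show ?case by blast
    qed
    have "uniform_limit {0..1} (\<lambda>\<epsilon>. Q \<epsilon> T) (Q 0 T) (at_right 0) \<and>
        uniform_limit {0..1} (\<lambda>\<epsilon>. P \<epsilon> T) (P 0 T) (at_right 0)"
    proof (intro conjI uniform_limitI)
      fix e :: real assume e: "e > 0"
      from Q_P_close[OF half_gt_zero[OF e]]
      show "\<forall>\<^sub>F \<epsilon> in at_right 0. \<forall>\<eta>\<in>{0..1}. dist (Q \<epsilon> T \<eta>) (Q 0 T \<eta>) < e"
        by eventually_elim (use e in \<open>auto simp: dist_real_def intro: le_less_trans[of _ "e / 2"]\<close>)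
      from Q_P_close[OF half_gt_zero[OF e]]
      show "\<forall>\<^sub>F \<epsilon> in at_right 0. \<forall>\<eta>\<in>{0..1}. dist (P \<epsilon> T \<eta>) (P 0 T \<eta>) < e"
        by eventually_elim (use e in \<open>auto simp: dist_real_def intro: le_less_trans[of _ "e / 2"]\<close>)
    qed
    then show ?thesis by (simp add: converges_C1_01_def P_def d_eta_def[abs_def])
  qed
  have "tm 0 \<le> Liminf (at_right 0) tm"
    unfolding le_Liminf_iff
  proof (intro allI impI)
    fix y assume "y < tm 0"
    moreover have "0 < tm 0" using cl[of 0] by (simp add: classical_solution_def)
    ultimately obtain T where T: "max y 0 < ereal T" "ereal T < tm 0"
      using ereal_dense2[of "max y 0" "tm 0"] by auto
    from T have "0 < T" by (simp flip: ereal_less(2))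
    from lifespan[OF this T(2)] show "\<forall>\<^sub>F \<epsilon> in at_right 0. y < tm \<epsilon>"
      by eventually_elim (use T in \<open>auto intro: less_le_trans\<close>)
  qed
  with N_lim Q_lim show ?thesis by (simp add: tm_def[abs_def])
qed

end
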